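(* Let $k$ be any field, $S=k[x,y,s,t]$, $F=xy(x-y)(sx-ty)=sx^3y-(t+s)x^2y^2+txy^3$, and $R=S/FS$. Let $\mathcal{S}$ be an infinite set of positive integers, and suppose that either $k$ has characteristic zero, or $k$ has prime characteristic $p$ and $\mathcal{S}$ contains infinitely many powers of $p$. Then the set $$\bigcup_{n\in\mathcal{S}}\operatorname{Ass}_R\left(\frac{R}{\langle x^n,y^n\rangle}\right)$$ is infinite.
   Context: $\langle x^n,y^n\rangle$ denotes the ideal of $R$ generated by the images of $x^n$ and $y^n$; $\operatorname{Ass}_R$ denotes the set of associated prime ideals of an $R$-module. *)

theory Defs
  imports "HOL-Algebra.Algebra" "HOL-Computational_Algebra.Primes"
begin

text \<open>The polynomial ring S = k[x,y,s,t] is built as the iterated univariate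
  polynomial ring ((k[x])[y])[s])[t].\<close>

definition P1 :: "('a, 'm) ring_scheme \<Rightarrow> _" where "P1 K = UP K"
definition P2 :: "('a, 'm) ring_scheme \<Rightarrow> _" where "P2 K = UP (P1 K)"
definition P3 :: "('a, 'm) ring_scheme \<Rightarrow> _" where "P3 K = UP (P2 K)"
definition Spoly :: "('a, 'm) ring_scheme \<Rightarrow> _" where "Spoly K = UP (P3 K)"

definition varx where
  "varx K = monom (Spoly K) (monom (P3 K) (monom (P2 K) (monom (P1 K) \<one>\<^bsub>K\<^esub> 1) 0) 0) 0"
definition vary where
  "vary K = monom (Spoly K) (monom (P3 K) (monom (P2 K) \<one>\<^bsub>P1 K\<^esub> 1) 0) 0"
definition vars where
  "vars K = monom (Spoly K) (monom (P3 K) \<one>\<^bsub>P2 K\<^esub> 1) 0"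
definition vart where
  "vart K = monom (Spoly K) \<one>\<^bsub>P3 K\<^esub> 1"

definition polyF where
  "polyF K = (let S = Spoly K; x = varx K; y = vary K; s = vars K; t = vart K in
     x \<otimes>\<^bsub>S\<^esub> y \<otimes>\<^bsub>S\<^esub> (x \<ominus>\<^bsub>S\<^esub> y) \<otimes>\<^bsub>S\<^esub> (s \<otimes>\<^bsub>S\<^esub> x \<ominus>\<^bsub>S\<^esub> t \<otimes>\<^bsub>S\<^esub> y))"

definition ringR where
  "ringR K = Spoly K Quot (PIdl\<^bsub>Spoly K\<^esub> (polyF K))"
definition xR where
  "xR K = (PIdl\<^bsub>Spoly K\<^esub> (polyF K)) +>\<^bsub>Spoly K\<^esub> (varx K)"
definition yR where
  "yR K = (PIdl\<^bsub>Spoly K\<^esub> (polyF K)) +>\<^bsub>Spoly K\<^esub> (vary K)"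

text \<open>Ass_R(R/J): prime ideals of R that are annihilators of elements a + J of R/J,
  i.e. of the form (J : a) = {r. r a \<in> J}.\<close>
definition ass_quot :: "('b, 'c) ring_scheme \<Rightarrow> 'b set \<Rightarrow> 'b set set" where
  "ass_quot R J = {P. primeideal P R \<and>
      (\<exists>a \<in> carrier R. P = {r \<in> carrier R. r \<otimes>\<^bsub>R\<^esub> a \<in> J})}"

end

theory Submission
  imports Defs
begin

text \<open>
  Put \<open>n = m + 2\<close>, \<open>N = m + 1\<close>, \<open>J = (x\<^sup>n, y\<^sup>n, F)\<close>, and suppose that \<open>N\<close> is invertible in \<open>K\<close>. For an
  \<open>N\<close>-th root of unity \<open>\<zeta> \<noteq> 1\<close> in an algebraically closed extension \<open>L\<close> of \<open>K\<close>, let \<open>P\<^sub>\<zeta>\<close> be the kernel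
  of \<open>S \<rightarrow> L[w]\<close>, \<open>x, y \<mapsto> 0\<close>, \<open>s \<mapsto> w\<close>, \<open>t \<mapsto> \<zeta> w\<close>. Then the annihilator of \<open>e = s x\<^sup>2 y\<^sup>N\<close> modulo \<open>J\<close>
  is the intersection of the primes \<open>P\<^sub>\<zeta>\<close>.

  Indeed, \<open>e\<close> is killed by \<open>x\<close>, by \<open>y\<close> and by \<open>G = (t\<^sup>N - s\<^sup>N) / (t - s)\<close>. A polynomial lying in every
  \<open>P\<^sub>\<zeta>\<close> belongs to \<open>(x, y, G)\<close>, since \<open>G\<close> is monic in \<open>t\<close> of degree \<open>N - 1\<close> and the \<open>\<zeta> w\<close> are \<open>N - 1\<close>
  distinct roots of it. Conversely, restrict an identity \<open>g x\<^sup>2 y\<^sup>N = p x\<^sup>n + q y\<^sup>n + r F\<close> to the four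
  lines \<open>y = 0\<close>, \<open>x = 0\<close>, \<open>x = y\<close>, \<open>x = \<zeta> y\<close> on which \<open>F\<close> vanishes once \<open>t = \<zeta> s\<close>, and compare
  coefficients in degree \<open>n + 1\<close>: this gives \<open>g \<in> P\<^sub>\<zeta>\<close>.

  So the minimal ones among the finitely many \<open>P\<^sub>\<zeta>\<close> are associated primes. Such a prime contains
  \<open>t\<^sup>N - s\<^sup>N\<close>, and it lies below \<open>P\<^sub>\<zeta>\<close> only if \<open>\<zeta>\<^sup>N = 1\<close>; hence it lies below finitely many \<open>P\<^sub>\<zeta>\<close>. Letting
  \<open>n\<close> vary gives infinitely many \<open>\<zeta>\<close>, hence infinitely many primes.
\<close>

section \<open>Ideals and associated primes\<close>

lemma (in ring_hom_ring) kernel_primeideal: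
  assumes "cring R" "domain S"
  shows "primeideal (a_kernel R S h) R"
proof (rule primeidealI[OF kernel_is_ideal \<open>cring R\<close>])
  have mem_iff: "a \<in> a_kernel R S h \<longleftrightarrow> h a = \<zero>\<^bsub>S\<^esub>" if "a \<in> carrier R" for a
    using that unfolding a_kernel_def' by blast
  have "\<one> \<notin> a_kernel R S h"
    using mem_iff[OF R.one_closed] domain.one_not_zero[OF \<open>domain S\<close>] by simp
  then show "carrier R \<noteq> a_kernel R S h" using R.one_closed by blast
  show "a \<in> a_kernel R S h \<or> b \<in> a_kernel R S h"
    if "a \<in> carrier R" "b \<in> carrier R" "a \<otimes> b \<in> a_kernel R S h" for a b
    using that mem_iff domain.integral[OF \<open>domain S\<close>, of "h a" "h b"] by simp
qed

lemma (in primeideal) exists_mem_all_notin: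
  assumes "finite \<A>" and "\<And>A. A \<in> \<A> \<Longrightarrow> ideal A R \<and> \<not> A \<subseteq> I"
  shows "\<exists>v \<in> carrier R - I. \<forall>A \<in> \<A>. v \<in> A"
  using assms
proof (induction \<A> rule: finite_induct)
  case empty
  then show ?case using I_notcarr a_subset by blast
next
  case (insert A \<A>)
  then obtain v where v: "v \<in> carrier R - I" "\<forall>B \<in> \<A>. v \<in> B" by auto
  interpret A: ideal A R using insert.prems by simp
  obtain a where a: "a \<in> A" "a \<notin> I" using insert.prems by blast
  have "v \<otimes> a \<in> carrier R - I" using v a I_prime[of v a] A.Icarr by auto
  moreover have "v \<otimes> a \<in> A" using v a by (simp add: A.I_l_closed)
  moreover have "v \<otimes> a \<in> B" if "B \<in> \<A>" for B
    using insert.prems that v a A.Icarr by (simp add: ideal.I_r_closed)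
  ultimately show ?case by blast
qed

lemma minimal_prime_eq_colon:
  fixes R (structure)
  assumes fin: "finite \<P>" and prime: "\<And>P. P \<in> \<P> \<Longrightarrow> primeideal P R" and "P \<in> \<P>"
  obtains Q v where "Q \<in> \<P>" "Q \<subseteq> P" "v \<in> carrier R" "Q = {r \<in> carrier R. \<forall>A \<in> \<P>. r \<otimes> v \<in> A}"
proof -
  obtain Q where Q: "Q \<in> \<P>" "Q \<subseteq> P" and minimal: "\<And>A. A \<in> \<P> \<Longrightarrow> A \<subseteq> Q \<Longrightarrow> A = Q"
    using finite_has_minimal2[OF fin \<open>P \<in> \<P>\<close>] by blast
  interpret Q: primeideal Q R by (rule prime[OF Q(1)])
  have "ideal A R \<and> \<not> A \<subseteq> Q" if "A \<in> \<P> - {Q}" for A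
    using that prime[of A] minimal[of A] by (auto simp: primeideal_def)
  then obtain v where v: "v \<in> carrier R - Q" "\<forall>A \<in> \<P> - {Q}. v \<in> A"
    using Q.exists_mem_all_notin[of "\<P> - {Q}"] fin by auto
  have "r \<otimes> v \<in> A" if "r \<in> Q" "A \<in> \<P>" for r A
  proof (cases "A = Q")
    case True
    then show ?thesis using that v by (simp add: Q.I_r_closed)
  next
    case False
    then show ?thesis
      using that v prime[of A] Q.Icarr by (simp add: primeideal_def ideal.I_l_closed)
  qed
  moreover have "r \<in> Q" if "r \<in> carrier R" "r \<otimes> v \<in> Q" for r
    using that v Q.I_prime[of r v] by auto
  ultimately have "Q = {r \<in> carrier R. \<forall>A \<in> \<P>. r \<otimes> v \<in> A}"
    using Q(1) Q.Icarr by blast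
  with Q v that show thesis by blast
qed

lemma (in cring) genideal_insert_subset:
  assumes a: "a \<in> carrier R" and A: "A \<subseteq> carrier R"
  shows "Idl (insert a A) \<subseteq> {r \<otimes> a \<oplus> u | r u. r \<in> carrier R \<and> u \<in> Idl A}"
proof -
  interpret A: ideal "Idl A" R by (rule genideal_ideal[OF A])
  have set_add: "PIdl a <+>\<^bsub>R\<^esub> Idl A = {r \<otimes> a \<oplus> u | r u. r \<in> carrier R \<and> u \<in> Idl A}"
    unfolding set_add_def' cgenideal_def by blast
  have "a = \<one> \<otimes> a \<oplus> \<zero>" using a by simp
  moreover have "u = \<zero> \<otimes> a \<oplus> u" if "u \<in> Idl A" for u using a A.Icarr[OF that] by simp
  ultimately have "insert a A \<subseteq> PIdl a <+>\<^bsub>R\<^esub> Idl A"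
    unfolding set_add using genideal_self[OF A] A.zero_closed one_closed zero_closed by blast
  then show ?thesis
    unfolding set_add[symmetric] by (intro genideal_minimal add_ideals cgenideal_ideal a A.is_ideal)
qed

lemma (in cring) genideal_Un_cgenideal:
  assumes a: "a \<in> carrier R" and A: "A \<subseteq> carrier R"
  shows "Idl (A \<union> PIdl a) = Idl (insert a A)"
proof
  have ins: "insert a A \<subseteq> carrier R" using assms by simp
  have sub: "A \<union> PIdl a \<subseteq> carrier R"
    using A ideal.Icarr[OF cgenideal_ideal[OF a]] by blast
  have "PIdl a \<subseteq> Idl (insert a A)"
    using genideal_self[OF ins] by (intro cgenideal_minimal genideal_ideal ins) blast
  then show "Idl (A \<union> PIdl a) \<subseteq> Idl (insert a A)"
    using genideal_self[OF ins] by (intro genideal_minimal genideal_ideal ins) blast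
  show "Idl (insert a A) \<subseteq> Idl (A \<union> PIdl a)"
    using genideal_self[OF sub] cgenideal_self[OF a]
    by (intro genideal_minimal genideal_ideal sub) blast
qed

lemma (in ring) ass_quot_superset:
  assumes "ideal J R" "P \<in> ass_quot R J"
  shows "J \<subseteq> P"
  using assms ideal.I_r_closed[OF assms(1)] ideal.Icarr[OF assms(1)] unfolding ass_quot_def by blast

context ideal
begin

lemma quotient_carrier: "carrier (R Quot I) = (+>) I ` carrier R"
  by (auto simp: FactRing_def A_RCOSETS_def')

lemma coset_eq_zero_iff:
  assumes "r \<in> carrier R"
  shows "I +> r = \<zero>\<^bsub>R Quot I\<^esub> \<longleftrightarrow> r \<in> I"
  using a_rcos_const[of r] a_rcos_self[OF assms] by (auto simp: FactRing_def)

lemma coset_image_mem_iff: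
  assumes J: "ideal J R" "I \<subseteq> J" and r: "r \<in> carrier R"
  shows "I +> r \<in> (+>) I ` J \<longleftrightarrow> r \<in> J"
proof
  assume "I +> r \<in> (+>) I ` J"
  then obtain j where j: "j \<in> J" "I +> r = I +> j" by blast
  then have "r \<ominus> j \<in> I"
    using quotient_eq_iff_same_a_r_cos[OF is_ideal r] ideal.Icarr[OF J(1)] by simp
  then have "r \<ominus> j \<oplus> j \<in> J"
    using j J by (simp add: additive_subgroup.a_closed ideal.axioms(1) subsetD)
  then show "r \<in> J" using r ideal.Icarr[OF J(1) j(1)] by (simp add: minus_eq a_assoc l_neg)
qed simp

lemma genideal_coset_image:
  assumes A: "A \<subseteq> carrier R"
  shows "Idl\<^bsub>R Quot I\<^esub> ((+>) I ` A) = (+>) I ` (Idl (A \<union> I))"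
proof
  interpret Q: ring "R Quot I" by (rule quotient_is_ring)
  interpret q: ring_hom_ring R "R Quot I" "(+>) I" by (rule rcos_ring_hom_ring)
  have AI: "A \<union> I \<subseteq> carrier R" using A a_subset by simp
  show "Idl\<^bsub>R Quot I\<^esub> ((+>) I ` A) \<subseteq> (+>) I ` (Idl (A \<union> I))"
    using genideal_self[OF AI]
    by (intro Q.genideal_minimal ring_ideal_imp_quot_ideal is_ideal genideal_ideal AI) blast
  let ?J = "Idl\<^bsub>R Quot I\<^esub> ((+>) I ` A)"
  have qA: "(+>) I ` A \<subseteq> carrier (R Quot I)" using A q.hom_closed by blast
  interpret J: ideal ?J "R Quot I" by (rule Q.genideal_ideal[OF qA])
  have "Idl (A \<union> I) \<subseteq> {r \<in> carrier R. I +> r \<in> ?J}"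
  proof (rule genideal_minimal)
    show "ideal {r \<in> carrier R. I +> r \<in> ?J} R" by (rule q.ideal_vimage[OF J.is_ideal])
    have "I +> a \<in> ?J" if "a \<in> A" for a using Q.genideal_self[OF qA] that by blast
    moreover have "I +> i \<in> ?J" if "i \<in> I" for i
      using that coset_eq_zero_iff[of i] Icarr by simp
    ultimately show "A \<union> I \<subseteq> {r \<in> carrier R. I +> r \<in> ?J}" using AI by blast
  qed
  then show "(+>) I ` (Idl (A \<union> I)) \<subseteq> ?J" by blast
qed

lemma primeideal_coset_image:
  assumes "primeideal P R" "I \<subseteq> P"
  shows "primeideal ((+>) I ` P) (R Quot I)"
proof -
  interpret P: primeideal P R by fact
  interpret q: ring_hom_ring R "R Quot I" "(+>) I" by (rule rcos_ring_hom_ring)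
  note mem_iff = coset_image_mem_iff[OF P.is_ideal \<open>I \<subseteq> P\<close>]
  show ?thesis
  proof (rule primeidealI)
    show "ideal ((+>) I ` P) (R Quot I)" by (rule ring_ideal_imp_quot_ideal[OF is_ideal P.is_ideal])
    show "cring (R Quot I)" by (rule quotient_is_cring[OF P.is_cring])
    have "\<one> \<notin> P" using P.one_imp_carrier P.I_notcarr by blast
    then show "carrier (R Quot I) \<noteq> (+>) I ` P"
      using mem_iff[OF one_closed] q.hom_closed[OF one_closed] by blast
    fix u v assume "u \<in> carrier (R Quot I)" "v \<in> carrier (R Quot I)"
    then obtain a b where ab: "a \<in> carrier R" "b \<in> carrier R" "u = I +> a" "v = I +> b"
      unfolding quotient_carrier by blast
    assume "u \<otimes>\<^bsub>R Quot I\<^esub> v \<in> (+>) I ` P"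
    then have "I +> (a \<otimes> b) \<in> (+>) I ` P" using ab by simp
    then have "a \<in> P \<or> b \<in> P" using mem_iff[of "a \<otimes> b"] P.I_prime[of a b] ab by blast
    then show "u \<in> (+>) I ` P \<or> v \<in> (+>) I ` P" using ab by blast
  qed
qed

lemma ass_quot_coset_image:
  assumes J: "ideal J R" "I \<subseteq> J" and "P \<in> ass_quot R J"
  shows "(+>) I ` P \<in> ass_quot (R Quot I) ((+>) I ` J)"
proof -
  interpret q: ring_hom_ring R "R Quot I" "(+>) I" by (rule rcos_ring_hom_ring)
  obtain a where P: "primeideal P R" and a: "a \<in> carrier R"
    and P_eq: "P = {r \<in> carrier R. r \<otimes> a \<in> J}"
    using \<open>P \<in> ass_quot R J\<close> unfolding ass_quot_def by blast
  have "I \<subseteq> P" using J(2) ass_quot_superset[OF J(1) assms(3)] by (rule subset_trans)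
  have "(I +> r) \<otimes>\<^bsub>R Quot I\<^esub> (I +> a) \<in> (+>) I ` J \<longleftrightarrow> r \<otimes> a \<in> J" if r: "r \<in> carrier R" for r
    using coset_image_mem_iff[OF J m_closed[OF r a]] r a by simp
  then have "(+>) I ` P = {u \<in> carrier (R Quot I). u \<otimes>\<^bsub>R Quot I\<^esub> (I +> a) \<in> (+>) I ` J}"
    unfolding quotient_carrier P_eq by blast
  then show ?thesis
    using primeideal_coset_image[OF P \<open>I \<subseteq> P\<close>] q.hom_closed[OF a]
    unfolding ass_quot_def by blast
qed

end

section \<open>Polynomial rings\<close>

abbreviation const_UP where "const_UP R a \<equiv> up_ring.monom (UP R) a 0"
abbreviation var_UP where "var_UP R \<equiv> up_ring.monom (UP R) \<one>\<^bsub>R\<^esub> 1"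

lemma (in UP_cring) coeff_mult_monom:
  assumes "p \<in> carrier P" "a \<in> carrier R"
  shows "up_ring.coeff P (p \<otimes>\<^bsub>P\<^esub> up_ring.monom P a n) (k + n) = up_ring.coeff P p k \<otimes> a"
  using coeff_monom_mult[OF assms(2,1)] assms by (simp add: P.m_comm R.m_comm del: coeff_mult)

lemma eval_UP:
  assumes "cring R" "cring T" "\<psi> \<in> ring_hom R T" "\<xi> \<in> carrier T"
  shows "UnivPoly.eval R T \<psi> \<xi> \<in> ring_hom (UP R) T"
    and "UnivPoly.eval R T \<psi> \<xi> (var_UP R) = \<xi>"
    and "\<And>a. a \<in> carrier R \<Longrightarrow> UnivPoly.eval R T \<psi> \<xi> (const_UP R a) = \<psi> a"
proof -
  interpret UP_pre_univ_prop R T \<psi> "UP R" by (rule UP_pre_univ_propI[OF assms(1-3)]) simp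
  show "UnivPoly.eval R T \<psi> \<xi> \<in> ring_hom (UP R) T" by (rule eval_ring_hom[OF assms(4)])
  show "UnivPoly.eval R T \<psi> \<xi> (var_UP R) = \<xi>" by (rule eval_monom1[OF assms(4)])
  show "UnivPoly.eval R T \<psi> \<xi> (const_UP R a) = \<psi> a" if "a \<in> carrier R" for a
    by (rule eval_const[OF assms(4) that])
qed

lemma UP_hom_eqI:
  assumes R: "cring R" and T: "cring T" and g: "g \<in> ring_hom (UP R) T"
    and h: "h \<in> ring_hom (UP R) T"
    and const: "\<And>a. a \<in> carrier R \<Longrightarrow> g (const_UP R a) = h (const_UP R a)"
    and var: "g (var_UP R) = h (var_UP R)" and p: "p \<in> carrier (UP R)"
  shows "g p = h p"
proof -
  interpret P: UP_cring R "UP R" using R by (simp_all add: UP_cring_def)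
  have "h \<circ> const_UP R \<in> ring_hom R T" by (rule ring_hom_trans[OF P.const_ring_hom h])
  then interpret UP_pre_univ_prop R T "h \<circ> const_UP R" "UP R"
    by (rule UP_pre_univ_propI[OF R T]) simp
  have closed: "h (var_UP R) \<in> carrier T"
    by (intro ring_hom_closed[OF h] P.monom_closed P.R.one_closed)
  show ?thesis
    by (rule UP_hom_unique[OF ring_homD[OF g] _ _ ring_homD[OF h] _ _ p closed])
      (simp_all add: const var[unfolded One_nat_def])
qed

lemma coeff_UP: "p \<in> carrier (UP R) \<Longrightarrow> up_ring.coeff (UP R) p = p"
  by (simp add: UP_def)

lemma (in ring_hom_cring) comp_UP_ring_hom: "(\<circ>) h \<in> ring_hom (UP R) (UP S)"
proof -
  interpret R: UP_cring R "UP R" by unfold_locales simp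
  interpret S: UP_cring S "UP S" by unfold_locales simp
  have closed: "h \<circ> p \<in> carrier (UP S)" if p: "p \<in> carrier (UP R)" for p
  proof -
    obtain n where "bound \<zero>\<^bsub>R\<^esub> n p" "p \<in> UNIV \<rightarrow> carrier R" using p by (auto simp: UP_def up_def)
    then have "bound \<zero>\<^bsub>S\<^esub> n (h \<circ> p)" "h \<circ> p \<in> UNIV \<rightarrow> carrier S" by (simp_all add: bound_def Pi_iff)
    then show ?thesis by (auto simp: UP_def up_def)
  qed
  have coeff: "up_ring.coeff (UP S) (h \<circ> p) n = h (up_ring.coeff (UP R) p n)"
    if "p \<in> carrier (UP R)" for p n
    using that by (simp add: coeff_UP closed)
  show ?thesis
  proof (rule ring_hom_memI)
    fix p q assume [simp]: "p \<in> carrier (UP R)" "q \<in> carrier (UP R)"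
    show "h \<circ> p \<in> carrier (UP S)" by (rule closed) simp
    show "h \<circ> (p \<otimes>\<^bsub>UP R\<^esub> q) = (h \<circ> p) \<otimes>\<^bsub>UP S\<^esub> (h \<circ> q)"
      by (rule S.up_eqI) (simp_all add: coeff closed Pi_def, simp add: comp_def)
    show "h \<circ> (p \<oplus>\<^bsub>UP R\<^esub> q) = (h \<circ> p) \<oplus>\<^bsub>UP S\<^esub> (h \<circ> q)"
      by (rule S.up_eqI) (simp_all add: coeff closed)
  next
    show "h \<circ> \<one>\<^bsub>UP R\<^esub> = \<one>\<^bsub>UP S\<^esub>"
      by (rule S.up_eqI) (simp_all add: coeff closed)
  qed
qed

lemma (in ring_hom_cring) comp_monom:
  "a \<in> carrier R \<Longrightarrow> h \<circ> up_ring.monom (UP R) a n = up_ring.monom (UP S) (h a) n"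
  by (auto simp: UP_def)

lemma (in ring_hom_cring) deg_comp_UP:
  assumes inj: "inj_on h (carrier R)" and p: "p \<in> carrier (UP R)"
  shows "deg S (h \<circ> p) = deg R p"
proof -
  have "h (p n) = \<zero>\<^bsub>S\<^esub> \<longleftrightarrow> p n = \<zero>" for n
    using inj_onD[OF inj, of "p n" \<zero>] p by (auto simp: UP_def up_def)
  then have "bound \<zero>\<^bsub>S\<^esub> n (h \<circ> p) \<longleftrightarrow> bound \<zero> n p" for n
    by (simp add: bound_def)
  then show ?thesis
    using p ring_hom_closed[OF comp_UP_ring_hom p] by (simp add: deg_def coeff_UP)
qed

lemma (in ring_hom_cring) eval_comp_UP:
  assumes "inj_on h (carrier R)" and "p \<in> carrier (UP R)"
  shows "UnivPoly.eval S S id z (h \<circ> p) = UnivPoly.eval R S h z p"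
  using assms ring_hom_closed[OF comp_UP_ring_hom assms(2)]
  by (simp add: UnivPoly.eval_def coeff_UP deg_comp_UP)

lemma inj_on_comp_UP:
  assumes "inj_on h (carrier R)" shows "inj_on ((\<circ>) h) (carrier (UP R))"
proof (rule inj_onI, rule ext)
  fix p q n assume "p \<in> carrier (UP R)" "q \<in> carrier (UP R)" "h \<circ> p = h \<circ> q"
  then have "p n \<in> carrier R" "q n \<in> carrier R" "h (p n) = h (q n)"
    by (auto simp: UP_def up_def fun_eq_iff)
  then show "p n = q n" using assms by (simp add: inj_onD)
qed

lemma (in UP_domain) eq_zero_if_roots_exceed_deg:
  assumes "finite Z" "Z \<subseteq> carrier R" "p \<in> carrier P" "\<And>z. z \<in> Z \<Longrightarrow> UnivPoly.eval R R id z p = \<zero>"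
    and "deg R p < card Z"
  shows "p = \<zero>\<^bsub>P\<^esub>"
  using assms
proof (induction Z arbitrary: p rule: finite_induct)
  case (insert a Z)
  have a [simp]: "a \<in> carrier R" using insert.prems(1) by simp
  have nontrivial: "carrier R \<noteq> {\<zero>}" using R.carrier_one_not_zero R.one_not_zero by simp
  let ?l = "up_ring.monom P \<one> 1 \<ominus>\<^bsub>P\<^esub> up_ring.monom P a 0"
  obtain q where q: "q \<in> carrier P" and p: "p = ?l \<otimes>\<^bsub>P\<^esub> q"
    using remainder_theorem[OF insert.prems(2) a nontrivial] insert.prems(3)[of a] by auto
  have roots: "UnivPoly.eval R R id z q = \<zero>" if z: "z \<in> Z" for z
  proof -
    have zc: "z \<in> carrier R" and "z \<noteq> a" using insert z by auto
    interpret UP_pre_univ_prop R R id P by unfold_locales simp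
    interpret e: ring_hom_cring P R "UnivPoly.eval R R id z"
      by (rule ring_homD[OF eval_ring_hom[OF zc]])
    have "(z \<ominus> a) \<otimes> UnivPoly.eval R R id z q = UnivPoly.eval R R id z p"
      unfolding p using zc q eval_monom1[OF zc] eval_const[OF zc a] by simp
    also have "\<dots> = \<zero>" using insert.prems(3) z by blast
    finally have "(z \<ominus> a) \<otimes> UnivPoly.eval R R id z q = \<zero>" .
    then show ?thesis using zc \<open>z \<noteq> a\<close> e.hom_closed[OF q] by (simp add: R.integral_iff)
  qed
  show ?case
  proof (rule ccontr)
    assume "p \<noteq> \<zero>\<^bsub>P\<^esub>"
    then have "q \<noteq> \<zero>\<^bsub>P\<^esub>" using q by (auto simp: p)
    moreover have deg_l: "deg R ?l = 1" by (rule deg_monom_minus[OF a nontrivial])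
    then have "?l \<noteq> \<zero>\<^bsub>P\<^esub>" by (intro deg_nzero_nzero) simp
    ultimately have "deg R p = 1 + deg R q" unfolding p using q deg_l by (subst deg_mult) simp_all
    then have "q = \<zero>\<^bsub>P\<^esub>" using insert.IH[OF _ q roots] insert.prems insert.hyps by simp
    with \<open>q \<noteq> \<zero>\<^bsub>P\<^esub>\<close> show False ..
  qed
qed simp


lemma (in UP_pre_univ_prop) monic_dvd_if_roots:
  assumes S: "domain S" and inj: "inj_on h (carrier R)"
    and f: "f \<in> carrier P" "up_ring.coeff P f (deg R f) = \<one>" "f \<noteq> \<zero>\<^bsub>P\<^esub>"
    and Z: "finite Z" "Z \<subseteq> carrier S" "deg R f \<le> card Z"
    and f_roots: "\<And>z. z \<in> Z \<Longrightarrow> UnivPoly.eval R S h z f = \<zero>\<^bsub>S\<^esub>"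
    and g: "g \<in> carrier P" and g_roots: "\<And>z. z \<in> Z \<Longrightarrow> UnivPoly.eval R S h z g = \<zero>\<^bsub>S\<^esub>"
  shows "\<exists>q \<in> carrier P. g = f \<otimes>\<^bsub>P\<^esub> q"
proof -
  interpret S: UP_domain S "UP S" using S by (simp_all add: UP_domain_def)
  obtain q r where q: "q \<in> carrier P" and r: "r \<in> carrier P" and g_eq: "g = f \<otimes>\<^bsub>P\<^esub> q \<oplus>\<^bsub>P\<^esub> r"
    and deg: "r = \<zero>\<^bsub>P\<^esub> \<or> deg R r < deg R f"
    using long_div_theorem[OF f(1) g f(3)] g by (auto simp: f(2))
  have "r = \<zero>\<^bsub>P\<^esub>"
  proof (rule ccontr)
    assume "r \<noteq> \<zero>\<^bsub>P\<^esub>"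
    then have "deg S (h \<circ> r) < card Z" using deg Z r deg_comp_UP[OF inj, of r] by (simp add: P_def)
    moreover have "UnivPoly.eval S S id z (h \<circ> r) = \<zero>\<^bsub>S\<^esub>" if "z \<in> Z" for z
    proof -
      have z: "z \<in> carrier S" using that Z by blast
      interpret e: ring_hom_cring P S "UnivPoly.eval R S h z"
        by (rule ring_homD[OF eval_ring_hom[OF z]])
      have "UnivPoly.eval R S h z r = UnivPoly.eval R S h z g"
        using f_roots[OF that] f q r z by (simp add: g_eq)
      then show ?thesis using eval_comp_UP[OF inj] g_roots[OF that] r by (simp add: P_def)
    qed
    ultimately have "h \<circ> r = \<zero>\<^bsub>UP S\<^esub>"
      using S.eq_zero_if_roots_exceed_deg[OF Z(1,2)] ring_hom_closed[OF comp_UP_ring_hom] r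
      by (simp add: P_def)
    also have "\<dots> = h \<circ> \<zero>\<^bsub>P\<^esub>" by (simp add: P_def UP_def fun_eq_iff)
    finally have "r = \<zero>\<^bsub>P\<^esub>"
      using inj_onD[OF inj_on_comp_UP[OF inj], of r "\<zero>\<^bsub>P\<^esub>"] r P.zero_closed by (simp add: P_def)
    with \<open>r \<noteq> \<zero>\<^bsub>P\<^esub>\<close> show False ..
  qed
  then show ?thesis using g_eq q f by auto
qed

section \<open>Geometric sums and the quartic form\<close>

context cring
begin

primrec geom_sum :: "'a \<Rightarrow> 'a \<Rightarrow> nat \<Rightarrow> 'a" where
  "geom_sum s t 0 = \<zero>"
| "geom_sum s t (Suc n) = s \<otimes> geom_sum s t n \<oplus> t [^] n"

lemma geom_sum_closed [simp]:
  "s \<in> carrier R \<Longrightarrow> t \<in> carrier R \<Longrightarrow> geom_sum s t n \<in> carrier R"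
  by (induction n) auto

lemma diff_mult_geom_sum:
  assumes [simp]: "s \<in> carrier R" "t \<in> carrier R"
  shows "(t \<ominus> s) \<otimes> geom_sum s t n = t [^] n \<ominus> s [^] n"
proof (induction n)
  case 0
  show ?case by (simp add: minus_eq r_neg)
next
  case (Suc n)
  have "(t \<ominus> s) \<otimes> (s \<otimes> g \<oplus> T) = s \<otimes> ((t \<ominus> s) \<otimes> g) \<oplus> (t \<ominus> s) \<otimes> T"
    if "g \<in> carrier R" "T \<in> carrier R" for g T
    using that assms by algebra
  moreover have "s \<otimes> (T \<ominus> U) \<oplus> (t \<ominus> s) \<otimes> T = T \<otimes> t \<ominus> U \<otimes> s"
    if "T \<in> carrier R" "U \<in> carrier R" for T U
    using that assms by algebra
  ultimately show ?case by (simp add: Suc)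
qed

lemma geom_sum_same:
  assumes z: "z \<in> carrier R"
  shows "geom_sum z z (Suc n) = add_pow R (Suc n) (z [^] n)"
proof (induction n)
  case (Suc n)
  have "geom_sum z z (Suc (Suc n)) = z \<otimes> add_pow R (Suc n) (z [^] n) \<oplus> z [^] Suc n"
    using Suc by (simp only: geom_sum.simps(2)[of z z "Suc n"])
  also have "z \<otimes> add_pow R (Suc n) (z [^] n) = add_pow R (Suc n) (z [^] Suc n)"
    using z by (subst add_pow_rdistr) (simp_all add: m_comm)
  finally show ?case using z by simp
qed (use z in simp)

text \<open>The differences of \<open>M\<close> form a geometric progression of ratio \<open>t / s\<close>.\<close>

lemma recurrence_geom_sum:
  fixes M :: "nat \<Rightarrow> 'a"
  assumes M [simp]: "\<And>j. M j \<in> carrier R" and [simp]: "s \<in> carrier R" "t \<in> carrier R"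
    and M0: "M 0 = \<zero>"
    and rec: "\<And>j. j < m \<Longrightarrow> s \<otimes> (M (Suc (Suc j)) \<ominus> M (Suc j)) = t \<otimes> (M (Suc j) \<ominus> M j)"
  shows "j \<le> m \<Longrightarrow> s [^] j \<otimes> M (Suc j) = geom_sum s t (Suc j) \<otimes> M 1"
proof (induction j)
  case 0
  show ?case by simp
next
  case (Suc j)
  have diff: "s [^] i \<otimes> (M (Suc i) \<ominus> M i) = t [^] i \<otimes> M 1" if "i \<le> m" for i
    using that
  proof (induction i)
    case 0
    show ?case by (simp add: M0 minus_eq)
  next
    case (Suc i)
    have "s [^] Suc i \<otimes> (M (Suc (Suc i)) \<ominus> M (Suc i)) = s [^] i \<otimes> (t \<otimes> (M (Suc i) \<ominus> M i))"
      using rec[of i] Suc.prems by (simp add: m_assoc)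
    also have "\<dots> = t \<otimes> (s [^] i \<otimes> (M (Suc i) \<ominus> M i))" by (simp add: m_lcomm)
    also have "\<dots> = t [^] Suc i \<otimes> M 1" using Suc by (simp add: m_ac)
    finally show ?case .
  qed
  have "s [^] Suc j \<otimes> M (Suc (Suc j))
      = s [^] Suc j \<otimes> (M (Suc (Suc j)) \<ominus> M (Suc j)) \<oplus> s \<otimes> (s [^] j \<otimes> M (Suc j))"
    by (simp add: minus_eq r_distr r_minus m_ac a_assoc l_neg)
  also have "\<dots> = t [^] Suc j \<otimes> M 1 \<oplus> s \<otimes> (geom_sum s t (Suc j) \<otimes> M 1)"
    using diff[OF Suc.prems] Suc by simp
  also have "\<dots> = geom_sum s t (Suc (Suc j)) \<otimes> M 1"
    unfolding geom_sum.simps(2)[of s t "Suc j"]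
    by (simp add: l_distr m_assoc a_comm del: geom_sum.simps(2))
  finally show ?case .
qed

end

lemma (in ring_hom_cring) hom_geom_sum:
  "s \<in> carrier R \<Longrightarrow> t \<in> carrier R \<Longrightarrow> h (R.geom_sum s t n) = S.geom_sum (h s) (h t) n"
  by (induction n) simp_all

lemma (in ring_hom_cring) hom_power_diff_quotient:
  assumes R: "domain R" and [simp]: "s \<in> carrier R" "t \<in> carrier R" "q \<in> carrier R"
    and "s \<noteq> t" and h: "h s = h t" and q: "(t \<ominus> s) \<otimes> q = t [^] Suc n \<ominus> s [^] Suc n"
  shows "h q = add_pow S (Suc n) (h t [^]\<^bsub>S\<^esub> n)"
proof -
  have "(t \<ominus> s) \<otimes> q = (t \<ominus> s) \<otimes> R.geom_sum s t (Suc n)"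
    unfolding q by (rule R.diff_mult_geom_sum[symmetric]) simp_all
  moreover have "t \<ominus> s \<noteq> \<zero>" using \<open>s \<noteq> t\<close> by simp
  ultimately have "q = R.geom_sum s t (Suc n)"
    using domain.m_lcancel[OF R, of "t \<ominus> s" q "R.geom_sum s t (Suc n)"]
    by (simp del: R.geom_sum.simps)
  then have "h q = S.geom_sum (h t) (h t) (Suc n)" by (simp only: hom_geom_sum assms(2,3) h)
  then show ?thesis by (simp only: S.geom_sum_same hom_closed assms(3))
qed

lemma (in UP_cring) coeff_geom_sum:
  assumes a: "a \<in> carrier R"
  shows "up_ring.coeff P (P.geom_sum (up_ring.monom P a 0) (up_ring.monom P \<one> 1) n) k
    = (if k < n then a [^] (n - 1 - k) else \<zero>)"
proof (induction n)
  case (Suc n)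
  have "a \<otimes> a [^] (n - 1 - k) = a [^] (n - k)" if "k < n"
  proof -
    have "n - k = Suc (n - 1 - k)" using that by simp
    then show ?thesis using a by (simp add: R.m_comm)
  qed
  then show ?case
    using a Suc by (auto simp: monom_mult_is_smult monom_pow)
qed simp

lemma (in UP_cring) geom_sum_monic:
  fixes n :: nat
  assumes a: "a \<in> carrier R" and "\<one> \<noteq> \<zero>"
  defines "g \<equiv> P.geom_sum (up_ring.monom P a 0) (up_ring.monom P \<one> 1) (Suc n)"
  shows "deg R g = n" and "up_ring.coeff P g (deg R g) = \<one>"
proof -
  have g: "g \<in> carrier P" using a by (simp add: g_def)
  have coeff: "up_ring.coeff P g k = (if k < Suc n then a [^] (n - k) else \<zero>)" for k
    using coeff_geom_sum[OF a, of "Suc n" k] by (simp only: g_def diff_Suc_1)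
  show deg: "deg R g = n"
  proof (rule antisym)
    show "deg R g \<le> n" by (rule deg_aboveI[OF _ g]) (simp add: coeff)
    show "n \<le> deg R g" using \<open>\<one> \<noteq> \<zero>\<close> by (intro deg_belowI g) (simp add: coeff)
  qed
  show "up_ring.coeff P g (deg R g) = \<one>" unfolding deg by (simp add: coeff)
qed

definition quartic :: "('a, 'b) ring_scheme \<Rightarrow> 'a \<Rightarrow> 'a \<Rightarrow> 'a \<Rightarrow> 'a \<Rightarrow> 'a" where
  "quartic R x y s t =
    x \<otimes>\<^bsub>R\<^esub> y \<otimes>\<^bsub>R\<^esub> (x \<ominus>\<^bsub>R\<^esub> y) \<otimes>\<^bsub>R\<^esub> (s \<otimes>\<^bsub>R\<^esub> x \<ominus>\<^bsub>R\<^esub> t \<otimes>\<^bsub>R\<^esub> y)"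

lemma (in cring) quartic_closed [simp]:
  "x \<in> carrier R \<Longrightarrow> y \<in> carrier R \<Longrightarrow> s \<in> carrier R \<Longrightarrow> t \<in> carrier R \<Longrightarrow> quartic R x y s t \<in> carrier R"
  by (simp add: quartic_def)

lemma (in ring_hom_cring) hom_quartic:
  "x \<in> carrier R \<Longrightarrow> y \<in> carrier R \<Longrightarrow> s \<in> carrier R \<Longrightarrow> t \<in> carrier R \<Longrightarrow>
    h (quartic R x y s t) = quartic S (h x) (h y) (h s) (h t)"
  by (simp add: quartic_def)

lemma (in cring) socle_relations:
  assumes [simp]: "x \<in> carrier R" "y \<in> carrier R" "s \<in> carrier R" "t \<in> carrier R"
    and xn: "x [^] (m + 2) = \<zero>" and yn: "y [^] (m + 2) = \<zero>" and F: "quartic R x y s t = \<zero>"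
  defines "e \<equiv> s \<otimes> (x [^] (2::nat) \<otimes> y [^] Suc m)"
  shows "x \<otimes> e = \<zero>" and "y \<otimes> e = \<zero>" and "geom_sum s t (Suc m) \<otimes> e = \<zero>"
proof -
  have closed: "x \<in> carrier R" "y \<in> carrier R" "s \<in> carrier R" "t \<in> carrier R" by simp_all
  have e: "e = s \<otimes> (x \<otimes> x \<otimes> (y [^] m \<otimes> y))" by (simp add: e_def numeral_2_eq_2)
  have y0: "y [^] m \<otimes> y \<otimes> y = \<zero>" using yn by simp
  note F = F[unfolded quartic_def]
  have "y \<otimes> e = s \<otimes> x \<otimes> x \<otimes> (y [^] m \<otimes> y \<otimes> y)"
    unfolding e by (simp add: m_ac)
  then show "y \<otimes> e = \<zero>" by (simp add: y0)
  have "x \<otimes> (s \<otimes> (x \<otimes> x \<otimes> (Y \<otimes> y))) = Y \<otimes> (x \<otimes> y \<otimes> (x \<ominus> y) \<otimes> (s \<otimes> x \<ominus> t \<otimes> y))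
      \<oplus> ((t \<oplus> s) \<otimes> x \<otimes> x \<ominus> t \<otimes> x \<otimes> y) \<otimes> (Y \<otimes> y \<otimes> y)" if "Y \<in> carrier R" for Y
    using that closed by algebra
  from this[of "y [^] m"] show "x \<otimes> e = \<zero>" by (simp add: e y0 F)
  define M where "M = (\<lambda>j. x [^] (j + 1) \<otimes> y [^] (m + 2 - j))"
  have "s \<otimes> (M (Suc (Suc j)) \<ominus> M (Suc j)) = t \<otimes> (M (Suc j) \<ominus> M j)" if "j < m" for j
  proof -
    obtain k where k: "m = j + k + 1" using \<open>j < m\<close> less_imp_Suc_add by force
    have "s \<otimes> (V \<otimes> x \<otimes> x \<otimes> x \<otimes> (W \<otimes> y) \<ominus> V \<otimes> x \<otimes> x \<otimes> (W \<otimes> y \<otimes> y))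
      = V \<otimes> W \<otimes> (x \<otimes> y \<otimes> (x \<ominus> y) \<otimes> (s \<otimes> x \<ominus> t \<otimes> y))
        \<oplus> t \<otimes> (V \<otimes> x \<otimes> x \<otimes> (W \<otimes> y \<otimes> y) \<ominus> V \<otimes> x \<otimes> (W \<otimes> y \<otimes> y \<otimes> y))"
      if "V \<in> carrier R" "W \<in> carrier R" for V W
      using that closed by algebra
    from this[of "x [^] j" "y [^] k"] show ?thesis
      by (simp add: M_def k F numeral_2_eq_2 numeral_3_eq_3)
  qed
  then have "s [^] m \<otimes> M (Suc m) = geom_sum s t (Suc m) \<otimes> M 1"
    by (intro recurrence_geom_sum[of M s t m m]) (simp_all add: M_def y0)
  then have "geom_sum s t (Suc m) \<otimes> (x [^] (2::nat) \<otimes> y [^] Suc m) = \<zero>"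
    using xn by (simp add: M_def numeral_2_eq_2 del: geom_sum.simps)
  then show "geom_sum s t (Suc m) \<otimes> e = \<zero>"
    by (simp add: e_def m_lcomm[of _ s] del: geom_sum.simps nat_pow_Suc)
qed

lemma (in UP_cring) quartic_monom:
  assumes [simp]: "a \<in> carrier R" "b \<in> carrier R" "c \<in> carrier R" "d \<in> carrier R"
  shows "quartic P (up_ring.monom P a 1) (up_ring.monom P b 1)
      (up_ring.monom P c 0) (up_ring.monom P d 0)
    = up_ring.monom P (quartic R a b c d) 4"
proof -
  have minus: "up_ring.monom P u n \<ominus>\<^bsub>P\<^esub> up_ring.monom P v n = up_ring.monom P (u \<ominus> v) n"
    if "u \<in> carrier R" "v \<in> carrier R" for u v n
    using that by (simp add: a_minus_def)
  have "quartic P (up_ring.monom P a 1) (up_ring.monom P b 1)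
      (up_ring.monom P c 0) (up_ring.monom P d 0)
    = up_ring.monom P (quartic R a b c d) (1 + 1 + 1 + (0 + 1))"
    unfolding quartic_def minus[OF assms(1,2)]
    by (simp only: monom_mult[symmetric] minus R.m_closed R.minus_closed assms)
  then show ?thesis by (simp add: numeral_eq_Suc)
qed

lemma (in domain) eq_zero_if_four_points:
  assumes closed: "c \<in> carrier R" "z \<in> carrier R" "\<alpha> \<in> carrier R" "\<beta> \<in> carrier R"
      "\<gamma> \<in> carrier R" "\<delta> \<in> carrier R"
    and z: "z [^] Suc m = \<one>" "z \<noteq> \<one>"
    and rel: "\<And>a b. (a, b) \<in> {(\<one>, \<zero>), (\<zero>, \<one>), (\<one>, \<one>), (z, \<one>)} \<Longrightarrow>
      c \<otimes> (a [^] (2::nat) \<otimes> b [^] Suc m)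
      = (a \<otimes> \<alpha> \<oplus> b \<otimes> \<beta>) \<otimes> a [^] (m + 2) \<oplus> (a \<otimes> \<gamma> \<oplus> b \<otimes> \<delta>) \<otimes> b [^] (m + 2)"
  shows "c = \<zero>"
proof -
  have "\<alpha> = \<zero>" using rel[of \<one> \<zero>] closed by simp
  have "\<delta> = \<zero>" using rel[of \<zero> \<one>] closed by (simp add: numeral_2_eq_2)
  have c: "c = \<beta> \<oplus> \<gamma>" using rel[of \<one> \<one>] closed by (simp add: \<open>\<alpha> = \<zero>\<close> \<open>\<delta> = \<zero>\<close>)
  have "z [^] (m + 2) = z" "z [^] (2::nat) = z \<otimes> z" using z closed by (simp_all add: numeral_2_eq_2)
  then have "c \<otimes> (z \<otimes> z) = z \<otimes> (\<beta> \<oplus> \<gamma>)"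
    using rel[of z \<one>] closed by (simp add: \<open>\<alpha> = \<zero>\<close> \<open>\<delta> = \<zero>\<close> r_distr m_comm)
  then have "z \<otimes> (z \<otimes> c) = z \<otimes> (\<one> \<otimes> c)"
    unfolding c[symmetric] using closed by (simp add: m_ac)
  moreover have "z \<noteq> \<zero>" using z by auto
  ultimately have "z \<otimes> c = \<one> \<otimes> c" using closed m_lcancel[of z] by simp
  then show ?thesis using m_rcancel[of c z \<one>] closed z by auto
qed

section \<open>Roots of unity\<close>

context field
begin

interpretation UP: domain "poly_ring R"
  by (rule univ_poly_is_domain[OF carrier_is_subring])

definition unity_poly :: "nat \<Rightarrow> 'a list" where
  "unity_poly N = X [^]\<^bsub>poly_ring R\<^esub> N \<ominus>\<^bsub>poly_ring R\<^esub> \<one>\<^bsub>poly_ring R\<^esub>"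

lemma unity_poly_closed: "unity_poly N \<in> carrier (poly_ring R)"
  using var_closed(1)[OF carrier_is_subring] by (simp add: unity_poly_def)

lemma eval_unity_poly:
  assumes z: "z \<in> carrier R"
  shows "eval (unity_poly N) z = z [^] N \<ominus> \<one>"
proof -
  interpret e: ring_hom_cring "poly_ring R" R "\<lambda>p. eval p z"
    by (rule eval_cring_hom[OF carrier_is_subring z])
  show ?thesis
    using e.hom_one e.hom_pow[of X N] var_closed(1)[OF carrier_is_subring] eval_var[OF z]
    by (simp add: unity_poly_def del: e.hom_one)
qed

lemma degree_unity_poly:
  assumes "N > 0" shows "degree (unity_poly N) = N"
proof -
  have X: "X [^]\<^bsub>poly_ring R\<^esub> N = monom \<one> N"
    using unitary_monom_eq_var_pow[OF carrier_is_subring] by simp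
  have "degree (\<ominus>\<^bsub>poly_ring R\<^esub> \<one>\<^bsub>poly_ring R\<^esub>) = 0"
    using univ_poly_a_inv_degree[OF carrier_is_subring UP.one_closed] by (simp add: univ_poly_one)
  then show ?thesis
    using poly_add_degree_eq[OF carrier_is_subring,
        of "monom \<one> N" "\<ominus>\<^bsub>poly_ring R\<^esub> \<one>\<^bsub>poly_ring R\<^esub>"] \<open>N > 0\<close>
      UP.nat_pow_closed[OF var_closed(1)[OF carrier_is_subring], of N] UP.one_closed
    unfolding unity_poly_def UP.minus_eq univ_poly_add X
    by (simp add: monom_def univ_poly_carrier)
qed

lemma is_root_unity_poly:
  assumes "N > 0"
  shows "is_root (unity_poly N) z \<longleftrightarrow> z \<in> carrier R \<and> z [^] N = \<one>"
proof -
  have "unity_poly N \<noteq> []" using degree_unity_poly[OF assms] assms by auto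
  then show ?thesis
    unfolding is_root_def by (metis eval_unity_poly nat_pow_closed one_closed r_right_minus_eq)
qed

lemma eval_unity_poly_cofactor:
  assumes z: "z \<in> carrier R" "z [^] Suc n = \<one>" and q: "q \<in> carrier (poly_ring R)"
    and eq: "unity_poly (Suc n) = [\<one>, \<ominus> z] \<otimes>\<^bsub>poly_ring R\<^esub> q"
  shows "eval q z = add_pow R (Suc n) (z [^] n)"
proof -
  define c where "c = [z]"
  interpret const: ring_hom_cring R "poly_ring R" poly_of_const
    using canonical_embedding_ring_hom[OF carrier_is_subring]
    by (simp add: ring_hom_cring_def ring_hom_ring_def ring_hom_cring_axioms_def
        ring_hom_ring_axioms_def is_cring UP.is_cring)
  interpret e: ring_hom_cring "poly_ring R" R "\<lambda>p. eval p z"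
    by (rule eval_cring_hom[OF carrier_is_subring z(1)])
  have X: "X \<in> carrier (poly_ring R)" by (rule var_closed(1)[OF carrier_is_subring])
  have "z \<noteq> \<zero>" using z(2) by auto
  then have c: "c = poly_of_const z" by (simp add: c_def poly_of_const_def)
  then have c_closed: "c \<in> carrier (poly_ring R)" using z(1) by simp
  have "c [^]\<^bsub>poly_ring R\<^esub> Suc n = \<one>\<^bsub>poly_ring R\<^esub>"
    using const.hom_pow[OF z(1), of "Suc n"] const.hom_one by (simp only: c z(2))
  moreover have V: "[\<one>, \<ominus> z] \<in> carrier (poly_ring R)"
    using z(1) by (simp add: univ_poly_carrier[symmetric] polynomial_def)
  have "X = [\<one>, \<ominus> z] \<oplus>\<^bsub>poly_ring R\<^esub> c"
    using z(1) by (simp add: c_def var_def univ_poly_add l_neg)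
  then have "X \<ominus>\<^bsub>poly_ring R\<^esub> c = [\<one>, \<ominus> z]"
    using c_closed V by (simp add: UP.minus_eq UP.a_assoc UP.r_neg)
  ultimately have "(X \<ominus>\<^bsub>poly_ring R\<^esub> c) \<otimes>\<^bsub>poly_ring R\<^esub> q
      = X [^]\<^bsub>poly_ring R\<^esub> Suc n \<ominus>\<^bsub>poly_ring R\<^esub> c [^]\<^bsub>poly_ring R\<^esub> Suc n"
    using eq by (simp only: unity_poly_def)
  moreover have "c \<noteq> X" "eval c z = eval X z"
    using z(1) by (simp_all add: c_def var_def)
  ultimately have "eval q z = add_pow R (Suc n) (eval X z [^] n)"
    by (intro e.hom_power_diff_quotient[OF UP.domain_axioms c_closed X q])
  then show ?thesis by (simp only: eval_var[OF z(1)])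
qed

lemma alg_mult_unity_poly_le_one:
  assumes N: "add_pow R N \<one> \<noteq> \<zero>" and z: "z \<in> carrier R" "z [^] N = \<one>"
  shows "alg_mult (unity_poly N) z \<le> 1"
proof (rule ccontr)
  let ?v = "[\<one>, \<ominus> z]"
  obtain n where n: "N = Suc n" using N by (cases N) auto
  have v: "?v \<in> carrier (poly_ring R)"
    using z(1) by (simp add: univ_poly_carrier[symmetric] polynomial_def)
  assume "\<not> ?thesis"
  then have "(?v [^]\<^bsub>poly_ring R\<^esub> (2::nat)) pdivides (unity_poly N)"
    by (intro le_alg_mult_imp_pdivides z(1) unity_poly_closed) simp
  then obtain q where q: "q \<in> carrier (poly_ring R)"
    and "unity_poly N = ?v [^]\<^bsub>poly_ring R\<^esub> (2::nat) \<otimes>\<^bsub>poly_ring R\<^esub> q"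
    unfolding pdivides_def factor_def by blast
  then have "unity_poly (Suc n) = ?v \<otimes>\<^bsub>poly_ring R\<^esub> (?v \<otimes>\<^bsub>poly_ring R\<^esub> q)"
    using v by (simp add: n numeral_2_eq_2 UP.m_assoc)
  then have "eval (?v \<otimes>\<^bsub>poly_ring R\<^esub> q) z = add_pow R N (z [^] n)"
    using eval_unity_poly_cofactor z v q by (simp only: n UP.m_closed)
  moreover
  interpret e: ring_hom_cring "poly_ring R" R "\<lambda>p. eval p z"
    by (rule eval_cring_hom[OF carrier_is_subring z(1)])
  have "eval ?v z = \<zero>" using z(1) by (simp add: r_neg)
  then have "eval (?v \<otimes>\<^bsub>poly_ring R\<^esub> q) z = \<zero>" using e.hom_mult[OF v q] e.hom_closed[OF q] by simp
  ultimately have "add_pow R N (z [^] n \<otimes> z) = \<zero>"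
    using z(1) by (metis add_pow_ldistr l_null nat_pow_closed)
  then show False using N z by (simp add: n)
qed

end

definition (in field) nontrivial_unity_roots :: "nat \<Rightarrow> 'a set" where
  "nontrivial_unity_roots N = {z \<in> carrier R. z [^] N = \<one> \<and> z \<noteq> \<one>}"

lemma (in field) nontrivial_unity_rootsD:
  assumes "z \<in> nontrivial_unity_roots N"
  shows "z \<in> carrier R" "z [^] N = \<one>" "z \<noteq> \<one>"
  using assms unfolding nontrivial_unity_roots_def by blast+

context algebraically_closed
begin

lemma
  assumes N: "add_pow L N \<one> \<noteq> \<zero>"
  shows finite_nontrivial_unity_roots: "finite (nontrivial_unity_roots N)"
    and card_nontrivial_unity_roots: "card (nontrivial_unity_roots N) = N - 1"
proof -
  let ?p = "unity_poly N" and ?Z = "{z \<in> carrier L. z [^] N = \<one>}"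
  have "N > 0" using N by (cases N) auto
  have set: "set_mset (roots ?p) = ?Z"
    using roots_mem_iff_is_root[OF unity_poly_closed] is_root_unity_poly[OF \<open>N > 0\<close>] by blast
  then have fin: "finite ?Z" by (metis finite_set_mset)
  have "count (roots ?p) z = 1" if "z \<in># roots ?p" for z
    using that alg_mult_unity_poly_le_one[OF N, of z] set
    by (simp add: alg_mult_eq_count_roots[OF unity_poly_closed] order_antisym
        count_greater_eq_one_iff)
  then have "size (roots ?p) = card ?Z"
    by (simp add: size_multiset_overloaded_eq set)
  then have card: "card ?Z = N"
    using roots_over_carrier[OF unity_poly_closed, of N] degree_unity_poly[OF \<open>N > 0\<close>]
    by (simp add: splitted_def)
  have "nontrivial_unity_roots N = ?Z - {\<one>}" unfolding nontrivial_unity_roots_def by blast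
  then show "finite (nontrivial_unity_roots N)" "card (nontrivial_unity_roots N) = N - 1"
    using fin card by simp_all
qed

lemma infinite_nontrivial_unity_roots:
  assumes "infinite A" and A: "\<And>N. N \<in> A \<Longrightarrow> add_pow L N \<one> \<noteq> \<zero>"
  shows "infinite (\<Union>N \<in> A. nontrivial_unity_roots N)" (is "infinite ?Z")
proof
  assume "finite ?Z"
  obtain N where N: "N \<in> A" "card ?Z + 1 < N"
    using \<open>infinite A\<close> by (auto simp: infinite_nat_iff_unbounded)
  then have "card (nontrivial_unity_roots N) \<le> card ?Z"
    using \<open>finite ?Z\<close> by (intro card_mono) auto
  then show False using card_nontrivial_unity_roots[OF A[OF N(1)]] N(2) by linarith
qed

end

section \<open>The ring K[x, y, s, t]\<close>

definition Spoly_const :: "('a, 'm) ring_scheme \<Rightarrow> 'a \<Rightarrow> nat \<Rightarrow> nat \<Rightarrow> nat \<Rightarrow> nat \<Rightarrow> 'a" where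
  "Spoly_const K a = up_ring.monom (Spoly K)
    (up_ring.monom (P3 K) (up_ring.monom (P2 K) (up_ring.monom (P1 K) a 0) 0) 0) 0"

definition Spoly_eval where
  "Spoly_eval K T \<psi> \<xi> \<eta> \<sigma> \<tau> = UnivPoly.eval (P3 K) T (UnivPoly.eval (P2 K) T
    (UnivPoly.eval (P1 K) T (UnivPoly.eval K T \<psi> \<xi>) \<eta>) \<sigma>) \<tau>"

locale Spoly_cring = K: cring K for K :: "('a, 'm) ring_scheme" +
  fixes S (structure) and x y s t
  defines S_def: "S \<equiv> Spoly K"
    and x_def: "x \<equiv> varx K" and y_def: "y \<equiv> vary K" and s_def: "s \<equiv> vars K" and t_def: "t \<equiv> vart K"
begin

interpretation P1: UP_cring K "P1 K"
  by unfold_locales (simp add: P1_def)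
interpretation P2: UP_cring "P1 K" "P2 K"
  using P1.UP_cring by (simp_all add: UP_cring_def P2_def)
interpretation P3: UP_cring "P2 K" "P3 K"
  using P2.UP_cring by (simp_all add: UP_cring_def P3_def)
interpretation P4: UP_cring "P3 K" S
  using P3.UP_cring by (simp_all add: UP_cring_def S_def Spoly_def)

lemma cring_S: "cring S"
  by (rule P4.UP_cring)

lemma vars_closed [simp]: "x \<in> carrier S" "y \<in> carrier S" "s \<in> carrier S" "t \<in> carrier S"
  unfolding x_def y_def s_def t_def S_def varx_def vary_def vars_def vart_def
  by (simp_all add: P4.monom_closed[unfolded S_def])

lemma Spoly_const_ring_hom: "Spoly_const K \<in> ring_hom K S"
proof -
  have "Spoly_const K = (\<lambda>a. up_ring.monom S a 0) \<circ> ((\<lambda>a. up_ring.monom (P3 K) a 0) \<circ>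
      ((\<lambda>a. up_ring.monom (P2 K) a 0) \<circ> (\<lambda>a. up_ring.monom (P1 K) a 0)))"
    by (simp add: fun_eq_iff Spoly_const_def S_def)
  then show ?thesis
    using P1.const_ring_hom P2.const_ring_hom P3.const_ring_hom P4.const_ring_hom
    by (auto intro!: ring_hom_trans)
qed

lemma
  fixes \<xi> \<eta> \<sigma> \<tau>
  assumes T: "cring T" and \<psi>: "\<psi> \<in> ring_hom K T"
    and \<xi>: "\<xi> \<in> carrier T" and \<eta>: "\<eta> \<in> carrier T" and \<sigma>: "\<sigma> \<in> carrier T" and \<tau>: "\<tau> \<in> carrier T"
  shows Spoly_eval_ring_hom: "Spoly_eval K T \<psi> \<xi> \<eta> \<sigma> \<tau> \<in> ring_hom S T"
    and Spoly_eval_vars: "Spoly_eval K T \<psi> \<xi> \<eta> \<sigma> \<tau> x = \<xi>" "Spoly_eval K T \<psi> \<xi> \<eta> \<sigma> \<tau> y = \<eta>"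
      "Spoly_eval K T \<psi> \<xi> \<eta> \<sigma> \<tau> s = \<sigma>" "Spoly_eval K T \<psi> \<xi> \<eta> \<sigma> \<tau> t = \<tau>"
    and Spoly_eval_const: "\<And>a. a \<in> carrier K \<Longrightarrow> Spoly_eval K T \<psi> \<xi> \<eta> \<sigma> \<tau> (Spoly_const K a) = \<psi> a"
proof -
  note e1 = eval_UP[OF K.is_cring T \<psi> \<xi>, folded P1_def]
  note e2 = eval_UP[OF P1.UP_cring T e1(1) \<eta>, folded P2_def]
  note e3 = eval_UP[OF P2.UP_cring T e2(1) \<sigma>, folded P3_def]
  note e4 = eval_UP[OF P3.UP_cring T e3(1) \<tau>, folded Spoly_def S_def]
  show "Spoly_eval K T \<psi> \<xi> \<eta> \<sigma> \<tau> \<in> ring_hom S T"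
    unfolding Spoly_eval_def by (rule e4(1))
  show "Spoly_eval K T \<psi> \<xi> \<eta> \<sigma> \<tau> x = \<xi>" "Spoly_eval K T \<psi> \<xi> \<eta> \<sigma> \<tau> y = \<eta>"
      "Spoly_eval K T \<psi> \<xi> \<eta> \<sigma> \<tau> s = \<sigma>" "Spoly_eval K T \<psi> \<xi> \<eta> \<sigma> \<tau> t = \<tau>"
    by (simp_all add: Spoly_eval_def x_def y_def s_def t_def varx_def vary_def vars_def vart_def
        e1 e2 e3 e4 S_def[symmetric] del: One_nat_def)
  show "Spoly_eval K T \<psi> \<xi> \<eta> \<sigma> \<tau> (Spoly_const K a) = \<psi> a" if "a \<in> carrier K" for a
    using that by (simp add: Spoly_eval_def Spoly_const_def e1 e2 e3 e4 S_def[symmetric])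
qed

lemma Spoly_hom_eqI:
  assumes T: "cring T" and g: "g \<in> ring_hom S T" and h: "h \<in> ring_hom S T"
    and const: "\<And>a. a \<in> carrier K \<Longrightarrow> g (Spoly_const K a) = h (Spoly_const K a)"
    and vars: "g x = h x" "g y = h y" "g s = h s" "g t = h t" and p: "p \<in> carrier S"
  shows "g p = h p"
proof -
  let ?c2 = "\<lambda>q. up_ring.monom (P2 K) q 0" and ?c3 = "\<lambda>q. up_ring.monom (P3 K) q 0"
    and ?c4 = "\<lambda>q. up_ring.monom S q 0"
  note eqI1 = UP_hom_eqI[of K T, folded P1_def, OF K.is_cring T]
  note eqI2 = UP_hom_eqI[of "P1 K" T, folded P2_def, OF P1.UP_cring T]
  note eqI3 = UP_hom_eqI[of "P2 K" T, folded P3_def, OF P2.UP_cring T]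
  note eqI4 = UP_hom_eqI[of "P3 K" T, folded Spoly_def S_def, OF P3.UP_cring T]
  note defs = x_def y_def s_def t_def varx_def vary_def vars_def vart_def
    Spoly_const_def S_def[symmetric]
  have hom3: "f \<circ> ?c4 \<in> ring_hom (P3 K) T" if "f \<in> ring_hom S T" for f
    by (rule ring_hom_trans[OF P4.const_ring_hom that])
  have hom2: "f \<circ> ?c4 \<circ> ?c3 \<in> ring_hom (P2 K) T" if "f \<in> ring_hom S T" for f
    by (rule ring_hom_trans[OF P3.const_ring_hom hom3[OF that]])
  have hom1: "f \<circ> ?c4 \<circ> ?c3 \<circ> ?c2 \<in> ring_hom (P1 K) T" if "f \<in> ring_hom S T" for f
    by (rule ring_hom_trans[OF P2.const_ring_hom hom2[OF that]])
  have eq1: "(g \<circ> ?c4 \<circ> ?c3 \<circ> ?c2) q = (h \<circ> ?c4 \<circ> ?c3 \<circ> ?c2) q" if "q \<in> carrier (P1 K)" for q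
    by (rule eqI1[OF hom1[OF g] hom1[OF h] _ _ that]) (use const vars(1) in \<open>simp_all add: defs\<close>)
  have eq2: "(g \<circ> ?c4 \<circ> ?c3) q = (h \<circ> ?c4 \<circ> ?c3) q" if "q \<in> carrier (P2 K)" for q
    by (rule eqI2[OF hom2[OF g] hom2[OF h] _ _ that]) (use eq1 vars(2) in \<open>simp_all add: defs\<close>)
  have eq3: "(g \<circ> ?c4) q = (h \<circ> ?c4) q" if "q \<in> carrier (P3 K)" for q
    by (rule eqI3[OF hom3[OF g] hom3[OF h] _ _ that]) (use eq2 vars(3) in \<open>simp_all add: defs\<close>)
  show ?thesis
    by (rule eqI4[OF g h _ _ p]) (use eq3 vars(4) in \<open>simp_all add: defs\<close>)
qed

end

sublocale Spoly_cring \<subseteq> cring S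
  by (rule cring_S)

context Spoly_cring
begin

interpretation Ks: UP_cring K "UP K"
  by unfold_locales simp
interpretation Kst: UP_cring "UP K" "UP (UP K)"
  by unfold_locales simp

definition eval_xy_0 where
  "eval_xy_0 = Spoly_eval K (UP (UP K)) (const_UP (UP K) \<circ> const_UP K) \<zero>\<^bsub>UP (UP K)\<^esub> \<zero>\<^bsub>UP (UP K)\<^esub>
    (const_UP (UP K) (var_UP K)) (var_UP (UP K))"

definition embed_st where
  "embed_st = UnivPoly.eval (UP K) S (UnivPoly.eval K S (Spoly_const K) s) t"

lemma const_const_ring_hom: "const_UP (UP K) \<circ> const_UP K \<in> ring_hom K (UP (UP K))"
  by (rule ring_hom_trans[OF Ks.const_ring_hom Kst.const_ring_hom])

lemma eval_xy_0_ring_hom: "eval_xy_0 \<in> ring_hom S (UP (UP K))"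
  unfolding eval_xy_0_def by (intro Spoly_eval_ring_hom Kst.UP_cring const_const_ring_hom) simp_all

lemma eval_xy_0_gens:
  "eval_xy_0 x = \<zero>\<^bsub>UP (UP K)\<^esub>" "eval_xy_0 y = \<zero>\<^bsub>UP (UP K)\<^esub>"
  "eval_xy_0 s = const_UP (UP K) (var_UP K)" "eval_xy_0 t = var_UP (UP K)"
  "a \<in> carrier K \<Longrightarrow> eval_xy_0 (Spoly_const K a) = const_UP (UP K) (const_UP K a)"
  unfolding eval_xy_0_def
  by (simp_all add: Spoly_eval_vars Spoly_eval_const Kst.UP_cring const_const_ring_hom
      del: One_nat_def)

lemma embed_st_ring_hom: "embed_st \<in> ring_hom (UP (UP K)) S"
  and embed_st_gens: "embed_st (const_UP (UP K) (var_UP K)) = s" "embed_st (var_UP (UP K)) = t"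
    "a \<in> carrier K \<Longrightarrow> embed_st (const_UP (UP K) (const_UP K a)) = Spoly_const K a"
proof -
  note e1 = eval_UP[OF K.is_cring is_cring Spoly_const_ring_hom vars_closed(3)]
  note e2 = eval_UP[OF Ks.UP_cring is_cring e1(1) vars_closed(4)]
  show "embed_st \<in> ring_hom (UP (UP K)) S" unfolding embed_st_def by (rule e2(1))
  show "embed_st (const_UP (UP K) (var_UP K)) = s" "embed_st (var_UP (UP K)) = t"
    "a \<in> carrier K \<Longrightarrow> embed_st (const_UP (UP K) (const_UP K a)) = Spoly_const K a"
    by (simp_all add: embed_st_def e1 e2 del: One_nat_def)
qed

lemma eval_xy_0_decomposition:
  assumes p: "p \<in> carrier S"
  shows "\<exists>p1 \<in> carrier S. \<exists>p2 \<in> carrier S. p = embed_st (eval_xy_0 p) \<oplus> (x \<otimes> p1 \<oplus> y \<otimes> p2)"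
proof -
  define I where "I = Idl {x, y}"
  interpret I: ideal I S unfolding I_def by (intro genideal_ideal) simp
  interpret q: ring_hom_ring S "S Quot I" "(+>) I" by (rule I.rcos_ring_hom_ring)
  have "x \<in> I" "y \<in> I" using genideal_self[of "{x, y}"] by (simp_all add: I_def)
  have "I +> p = ((+>) I \<circ> (embed_st \<circ> eval_xy_0)) p"
  proof (rule Spoly_hom_eqI[OF _ _ _ _ _ _ _ _ p])
    show "cring (S Quot I)" by (rule I.quotient_is_cring[OF is_cring])
    show "(+>) I \<circ> (embed_st \<circ> eval_xy_0) \<in> ring_hom S (S Quot I)"
      by (intro ring_hom_trans[OF _ I.rcos_ring_hom]
          ring_hom_trans[OF eval_xy_0_ring_hom embed_st_ring_hom])
    have "embed_st \<zero>\<^bsub>UP (UP K)\<^esub> = \<zero>"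
      by (rule ring_hom_zero[OF embed_st_ring_hom]) (rule Kst.UP_ring, rule ring_axioms)
    then show "I +> x = ((+>) I \<circ> (embed_st \<circ> eval_xy_0)) x"
      "I +> y = ((+>) I \<circ> (embed_st \<circ> eval_xy_0)) y"
      using \<open>x \<in> I\<close> \<open>y \<in> I\<close> by (simp_all add: eval_xy_0_gens I.coset_eq_zero_iff)
  qed (simp_all add: I.rcos_ring_hom eval_xy_0_gens embed_st_gens del: One_nat_def)
  moreover have st: "embed_st (eval_xy_0 p) \<in> carrier S"
    by (intro ring_hom_closed[OF embed_st_ring_hom] ring_hom_closed[OF eval_xy_0_ring_hom] p)
  ultimately have "p \<ominus> embed_st (eval_xy_0 p) \<in> I"
    using quotient_eq_iff_same_a_r_cos[OF I.is_ideal p] by simp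
  then obtain p1 u where "p1 \<in> carrier S" "u \<in> Idl {y}" "p \<ominus> embed_st (eval_xy_0 p) = p1 \<otimes> x \<oplus> u"
    using genideal_insert_subset[of x "{y}"] unfolding I_def by auto
  moreover from \<open>u \<in> Idl {y}\<close> obtain p2 where "p2 \<in> carrier S" "u = p2 \<otimes> y"
    unfolding cgenideal_eq_genideal[OF vars_closed(2), symmetric] cgenideal_def by blast
  moreover have "p = embed_st (eval_xy_0 p) \<oplus> (p \<ominus> embed_st (eval_xy_0 p))"
    using p st by (simp add: minus_eq a_lcomm r_neg)
  ultimately show ?thesis by (metis m_comm vars_closed(1,2))
qed

lemma eval_xy_0_geom_sum:
  "eval_xy_0 (geom_sum s t n) = Kst.P.geom_sum (const_UP (UP K) (var_UP K)) (var_UP (UP K)) n"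
proof -
  interpret eval: ring_hom_cring S "UP (UP K)" eval_xy_0
    by (rule ring_hom_cringI[OF is_cring Kst.UP_cring eval_xy_0_ring_hom])
  show ?thesis by (simp only: eval.hom_geom_sum vars_closed eval_xy_0_gens)
qed

lemma embed_st_geom_sum: "embed_st (eval_xy_0 (geom_sum s t n)) = geom_sum s t n"
proof -
  interpret embed: ring_hom_cring "UP (UP K)" S embed_st
    by (rule ring_hom_cringI[OF Kst.UP_cring is_cring embed_st_ring_hom])
  show ?thesis
    by (simp only: eval_xy_0_geom_sum embed.hom_geom_sum embed_st_gens Kst.monom_closed
        Ks.monom_closed K.one_closed Ks.UP_one_closed)
qed

abbreviation F where
  "F \<equiv> quartic S x y s t"

definition power_ideal where
  "power_ideal n = Idl {F, x [^] (n::nat), y [^] n}"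

definition socle_elem where
  "socle_elem m = s \<otimes> (x [^] (2::nat) \<otimes> y [^] Suc m)"

lemma socle_elem_closed [simp]: "socle_elem m \<in> carrier S"
  by (simp add: socle_elem_def)

lemma ideal_power_ideal: "ideal (power_ideal n) S"
  unfolding power_ideal_def by (rule genideal_ideal) simp

lemma gens_mem_power_ideal: "F \<in> power_ideal n" "x [^] n \<in> power_ideal n" "y [^] n \<in> power_ideal n"
  using genideal_self[of "{F, x [^] n, y [^] n}"] by (simp_all add: power_ideal_def)

lemma mem_power_idealE:
  assumes "u \<in> power_ideal n"
  obtains p q r where "p \<in> carrier S" "q \<in> carrier S" "r \<in> carrier S"
    and "u = r \<otimes> F \<oplus> (p \<otimes> x [^] n \<oplus> q \<otimes> y [^] n)"
proof -
  obtain r v where r: "r \<in> carrier S" "v \<in> Idl {x [^] n, y [^] n}" "u = r \<otimes> F \<oplus> v"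
    using genideal_insert_subset[of "F" "{x [^] n, y [^] n}"] assms
    unfolding power_ideal_def by auto
  obtain p w where p: "p \<in> carrier S" "w \<in> Idl {y [^] n}" "v = p \<otimes> x [^] n \<oplus> w"
    using genideal_insert_subset[of "x [^] n" "{y [^] n}"] r(2) by auto
  obtain q where "q \<in> carrier S" "w = q \<otimes> y [^] n"
    using p(2)
    unfolding cgenideal_eq_genideal[OF nat_pow_closed[OF vars_closed(2)], symmetric] cgenideal_def
    by blast
  then show thesis using that r p by blast
qed

lemma socle_elem_relations:
  "x \<otimes> socle_elem m \<in> power_ideal (m + 2)" "y \<otimes> socle_elem m \<in> power_ideal (m + 2)"
  "geom_sum s t (Suc m) \<otimes> socle_elem m \<in> power_ideal (m + 2)"
proof -
  interpret J: ideal "power_ideal (m + 2)" S by (rule ideal_power_ideal)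
  let ?R = "S Quot power_ideal (m + 2)" and ?q = "\<lambda>u. power_ideal (m + 2) +> u"
  interpret Q: cring ?R by (rule J.quotient_is_cring[OF is_cring])
  interpret q: ring_hom_cring S ?R ?q
    by (rule ring_hom_cringI[OF is_cring Q.is_cring J.rcos_ring_hom])
  have "?q x [^]\<^bsub>?R\<^esub> (m + 2) = \<zero>\<^bsub>?R\<^esub>" "?q y [^]\<^bsub>?R\<^esub> (m + 2) = \<zero>\<^bsub>?R\<^esub>"
    "quartic ?R (?q x) (?q y) (?q s) (?q t) = \<zero>\<^bsub>?R\<^esub>"
    using gens_mem_power_ideal[of "m + 2"]
    by (simp_all only: q.hom_pow[symmetric] q.hom_quartic[symmetric] vars_closed nat_pow_closed
        quartic_closed J.coset_eq_zero_iff)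
  from Q.socle_relations[OF _ _ _ _ this]
  have "?q (x \<otimes> socle_elem m) = \<zero>\<^bsub>?R\<^esub>" "?q (y \<otimes> socle_elem m) = \<zero>\<^bsub>?R\<^esub>"
    "?q (geom_sum s t (Suc m) \<otimes> socle_elem m) = \<zero>\<^bsub>?R\<^esub>"
    by (simp_all only: socle_elem_def q.hom_mult q.hom_pow q.hom_geom_sum q.hom_closed vars_closed
        m_closed nat_pow_closed geom_sum_closed)
  then show "x \<otimes> socle_elem m \<in> power_ideal (m + 2)" "y \<otimes> socle_elem m \<in> power_ideal (m + 2)"
    "geom_sum s t (Suc m) \<otimes> socle_elem m \<in> power_ideal (m + 2)"
    by (simp_all only: J.coset_eq_zero_iff m_closed socle_elem_closed vars_closed geom_sum_closed)
qed

lemma combination_mult_socle_elem_mem: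
  assumes "q \<in> carrier S" "p1 \<in> carrier S" "p2 \<in> carrier S"
  shows "(geom_sum s t (Suc m) \<otimes> q \<oplus> (x \<otimes> p1 \<oplus> y \<otimes> p2)) \<otimes> socle_elem m \<in> power_ideal (m + 2)"
proof -
  interpret J: ideal "power_ideal (m + 2)" S by (rule ideal_power_ideal)
  have "(g \<otimes> q \<oplus> (x \<otimes> p1 \<oplus> y \<otimes> p2)) \<otimes> e = q \<otimes> (g \<otimes> e) \<oplus> (p1 \<otimes> (x \<otimes> e) \<oplus> p2 \<otimes> (y \<otimes> e))"
    if "g \<in> carrier S" "e \<in> carrier S" for g e
    using that assms vars_closed by algebra
  moreover have "q \<otimes> (geom_sum s t (Suc m) \<otimes> socle_elem m)
      \<oplus> (p1 \<otimes> (x \<otimes> socle_elem m) \<oplus> p2 \<otimes> (y \<otimes> socle_elem m)) \<in> power_ideal (m + 2)"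
    using assms socle_elem_relations[of m] by (simp only: J.a_closed J.I_l_closed)
  ultimately show ?thesis by (simp only: geom_sum_closed socle_elem_closed vars_closed)
qed

definition power_diffR where
  "power_diffR k = PIdl F +> (t [^] (k::nat) \<ominus> s [^] k)"

lemma ringR_eq: "ringR K = S Quot PIdl F" "xR K = PIdl F +> x" "yR K = PIdl F +> y"
  by (simp_all add: ringR_def xR_def yR_def polyF_def quartic_def Let_def S_def
      x_def y_def s_def t_def)

lemma ideal_F: "ideal (PIdl F) S"
  by (rule cgenideal_ideal) simp

lemma F_subset_power_ideal: "PIdl F \<subseteq> power_ideal n"
  by (rule cgenideal_minimal[OF ideal_power_ideal gens_mem_power_ideal(1)])

lemma power_ideal_coset_image:
  "(+>) (PIdl F) ` power_ideal n = Idl\<^bsub>ringR K\<^esub> {xR K [^]\<^bsub>ringR K\<^esub> n, yR K [^]\<^bsub>ringR K\<^esub> n}"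
proof -
  interpret I: ideal "PIdl F" S by (rule ideal_F)
  interpret q: ring_hom_cring S "S Quot PIdl F" "(+>) (PIdl F)"
    by (rule ring_hom_cringI[OF is_cring I.quotient_is_cring[OF is_cring] I.rcos_ring_hom])
  have "power_ideal n = Idl ({x [^] n, y [^] n} \<union> PIdl F)"
    unfolding power_ideal_def by (subst genideal_Un_cgenideal) simp_all
  then show ?thesis using I.genideal_coset_image[of "{x [^] n, y [^] n}"] by (simp add: ringR_eq)
qed

end

section \<open>Evaluation at roots of unity\<close>

locale Spoly_extension = Spoly_cring K S x y s t + K: field K + L: algebraically_closed L
  for K :: "('a, 'm) ring_scheme" and S (structure) and x y s t and L :: "('b, 'n) ring_scheme" +
  fixes \<iota>
  assumes \<iota>_ring_hom: "\<iota> \<in> ring_hom K L"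
begin

interpretation Ks: UP_domain K "UP K"
  by unfold_locales simp
interpretation Kst: UP_domain "UP K" "UP (UP K)"
  by unfold_locales simp
interpretation Lw: UP_domain L "UP L"
  by unfold_locales simp
interpretation Lwz: UP_domain "UP L" "UP (UP L)"
  by unfold_locales simp
interpretation \<iota>: ring_hom_cring K L \<iota>
  by (rule ring_hom_cringI[OF K.is_cring L.is_cring \<iota>_ring_hom])

lemma inj_on_\<iota>: "inj_on \<iota> (carrier K)"
  by (rule non_trivial_field_hom_is_inj[OF \<iota>_ring_hom K.field_axioms L.field_axioms])

lemma const_\<iota>_ring_hom: "const_UP L \<circ> \<iota> \<in> ring_hom K (UP L)"
  by (rule ring_hom_trans[OF \<iota>_ring_hom Lw.const_ring_hom])

definition root_eval where
  "root_eval \<zeta> = Spoly_eval K (UP L) (const_UP L \<circ> \<iota>) \<zero>\<^bsub>UP L\<^esub> \<zero>\<^bsub>UP L\<^esub>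
    (var_UP L) (up_ring.monom (UP L) \<zeta> 1)"

lemma root_eval_ring_hom: "\<zeta> \<in> carrier L \<Longrightarrow> root_eval \<zeta> \<in> ring_hom S (UP L)"
  unfolding root_eval_def by (intro Spoly_eval_ring_hom Lw.UP_cring const_\<iota>_ring_hom) simp_all

lemma root_eval_gens:
  assumes "\<zeta> \<in> carrier L"
  shows "root_eval \<zeta> x = \<zero>\<^bsub>UP L\<^esub>" "root_eval \<zeta> y = \<zero>\<^bsub>UP L\<^esub>"
    "root_eval \<zeta> s = var_UP L" "root_eval \<zeta> t = up_ring.monom (UP L) \<zeta> 1"
    "a \<in> carrier K \<Longrightarrow> root_eval \<zeta> (Spoly_const K a) = const_UP L (\<iota> a)"
  unfolding root_eval_def
  by (simp_all add: Spoly_eval_vars Spoly_eval_const Lw.UP_cring const_\<iota>_ring_hom assms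
      del: One_nat_def)

lemma root_eval_power_diff_eq_zero_iff:
  assumes \<zeta>: "\<zeta> \<in> carrier L"
  shows "root_eval \<zeta> (t [^] (k::nat) \<ominus> s [^] k) = \<zero>\<^bsub>UP L\<^esub> \<longleftrightarrow> \<zeta> [^]\<^bsub>L\<^esub> k = \<one>\<^bsub>L\<^esub>"
proof -
  interpret \<phi>: ring_hom_cring S "UP L" "root_eval \<zeta>"
    by (rule ring_hom_cringI[OF is_cring Lw.UP_cring root_eval_ring_hom[OF \<zeta>]])
  have "root_eval \<zeta> (t [^] k \<ominus> s [^] k)
      = up_ring.monom (UP L) (\<zeta> [^]\<^bsub>L\<^esub> k) k \<ominus>\<^bsub>UP L\<^esub> up_ring.monom (UP L) \<one>\<^bsub>L\<^esub> k"
    using \<zeta> by (simp add: root_eval_gens Lw.monom_pow)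
  then show ?thesis using \<zeta> Lw.monom_inj[of k] by (auto simp: inj_on_def)
qed

definition root_eval_st where
  "root_eval_st \<zeta> = UnivPoly.eval (UP K) (UP L) ((\<circ>) \<iota>) (up_ring.monom (UP L) \<zeta> 1)"

lemma
  assumes \<zeta>: "\<zeta> \<in> carrier L"
  shows root_eval_st_ring_hom: "root_eval_st \<zeta> \<in> ring_hom (UP (UP K)) (UP L)"
    and root_eval_st_gens: "root_eval_st \<zeta> (const_UP (UP K) (var_UP K)) = var_UP L"
      "root_eval_st \<zeta> (var_UP (UP K)) = up_ring.monom (UP L) \<zeta> 1"
      "a \<in> carrier K \<Longrightarrow> root_eval_st \<zeta> (const_UP (UP K) (const_UP K a)) = const_UP L (\<iota> a)"
proof -
  note e = eval_UP[OF Ks.UP_cring Lw.UP_cring \<iota>.comp_UP_ring_hom Lw.monom_closed[OF \<zeta>, of 1],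
      folded root_eval_st_def]
  show "root_eval_st \<zeta> \<in> ring_hom (UP (UP K)) (UP L)" by (rule e(1))
  show "root_eval_st \<zeta> (var_UP (UP K)) = up_ring.monom (UP L) \<zeta> 1" by (rule e(2))
  show "root_eval_st \<zeta> (const_UP (UP K) (var_UP K)) = var_UP L"
    "a \<in> carrier K \<Longrightarrow> root_eval_st \<zeta> (const_UP (UP K) (const_UP K a)) = const_UP L (\<iota> a)"
    using \<iota>.comp_monom by (simp_all add: e)
qed

lemma root_eval_eq_root_eval_st:
  assumes \<zeta>: "\<zeta> \<in> carrier L" and p: "p \<in> carrier S"
  shows "root_eval \<zeta> p = root_eval_st \<zeta> (eval_xy_0 p)"
proof -
  have "root_eval \<zeta> p = (root_eval_st \<zeta> \<circ> eval_xy_0) p"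
  proof (rule Spoly_hom_eqI[OF Lw.UP_cring root_eval_ring_hom[OF \<zeta>] _ _ _ _ _ _ p])
    show "root_eval_st \<zeta> \<circ> eval_xy_0 \<in> ring_hom S (UP L)"
      by (rule ring_hom_trans[OF eval_xy_0_ring_hom root_eval_st_ring_hom[OF \<zeta>]])
    have "root_eval_st \<zeta> \<zero>\<^bsub>UP (UP K)\<^esub> = \<zero>\<^bsub>UP L\<^esub>"
      by (rule ring_hom_zero[OF root_eval_st_ring_hom[OF \<zeta>] Kst.UP_ring Lw.UP_ring])
    then show "root_eval \<zeta> x = (root_eval_st \<zeta> \<circ> eval_xy_0) x"
      "root_eval \<zeta> y = (root_eval_st \<zeta> \<circ> eval_xy_0) y"
      by (simp_all add: root_eval_gens eval_xy_0_gens \<zeta>)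
  qed (simp_all add: root_eval_gens eval_xy_0_gens root_eval_st_gens \<zeta> del: One_nat_def)
  then show ?thesis by simp
qed

lemma root_eval_geom_sum:
  assumes "\<zeta> \<in> L.nontrivial_unity_roots N"
  shows "root_eval \<zeta> (geom_sum s t N) = \<zero>\<^bsub>UP L\<^esub>"
proof -
  have \<zeta>: "\<zeta> \<in> carrier L" "\<zeta> [^]\<^bsub>L\<^esub> N = \<one>\<^bsub>L\<^esub>" "\<zeta> \<noteq> \<one>\<^bsub>L\<^esub>"
    using L.nontrivial_unity_rootsD[OF assms] by simp_all
  interpret \<phi>: ring_hom_cring S "UP L" "root_eval \<zeta>"
    by (rule ring_hom_cringI[OF is_cring Lw.UP_cring root_eval_ring_hom[OF \<zeta>(1)]])
  have "root_eval \<zeta> (t \<ominus> s) \<otimes>\<^bsub>UP L\<^esub> root_eval \<zeta> (geom_sum s t N) = root_eval \<zeta> (t [^] N \<ominus> s [^] N)"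
    by (simp only: \<phi>.hom_mult[symmetric] diff_mult_geom_sum minus_closed geom_sum_closed
        vars_closed)
  moreover have "root_eval \<zeta> (t [^] N \<ominus> s [^] N) = \<zero>\<^bsub>UP L\<^esub>" "root_eval \<zeta> (t \<ominus> s) \<noteq> \<zero>\<^bsub>UP L\<^esub>"
    using \<zeta> root_eval_power_diff_eq_zero_iff[of \<zeta> N] root_eval_power_diff_eq_zero_iff[of \<zeta> 1]
    by simp_all
  ultimately show ?thesis by (simp add: Lw.integral_iff)
qed

lemma eval_xy_0_geom_sum_dvd:
  assumes N: "add_pow L (Suc m) \<one>\<^bsub>L\<^esub> \<noteq> \<zero>\<^bsub>L\<^esub>" and h: "h \<in> carrier (UP (UP K))"
    and zero: "\<And>\<zeta>. \<zeta> \<in> L.nontrivial_unity_roots (Suc m) \<Longrightarrow> root_eval_st \<zeta> h = \<zero>\<^bsub>UP L\<^esub>"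
  shows "\<exists>q \<in> carrier (UP (UP K)). h = eval_xy_0 (geom_sum s t (Suc m)) \<otimes>\<^bsub>UP (UP K)\<^esub> q"
proof -
  interpret E: UP_pre_univ_prop "UP K" "UP L" "(\<circ>) \<iota>" "UP (UP K)"
    by (rule UP_pre_univ_propI[OF Ks.UP_cring Lw.UP_cring \<iota>.comp_UP_ring_hom]) simp
  let ?G = "eval_xy_0 (geom_sum s t (Suc m))"
    and ?Z = "(\<lambda>\<zeta>. up_ring.monom (UP L) \<zeta> 1) ` L.nontrivial_unity_roots (Suc m)"
  have roots_closed: "L.nontrivial_unity_roots (Suc m) \<subseteq> carrier L"
    by (auto dest: L.nontrivial_unity_rootsD)
  have inj: "inj_on ((\<circ>) \<iota>) (carrier (UP K))" by (rule inj_on_comp_UP[OF inj_on_\<iota>])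
  have G: "?G \<in> carrier (UP (UP K))" by (intro ring_hom_closed[OF eval_xy_0_ring_hom]) simp
  note monic = Kst.geom_sum_monic[OF Ks.monom_closed[OF K.one_closed, of 1] Ks.UP_one_not_zero,
      of m, folded eval_xy_0_geom_sum]
  have "?G \<noteq> \<zero>\<^bsub>UP (UP K)\<^esub>" using monic(2) Ks.UP_one_not_zero by (metis Kst.coeff_zero)
  have "inj_on (\<lambda>\<zeta>. up_ring.monom (UP L) \<zeta> 1) (L.nontrivial_unity_roots (Suc m))"
    by (rule inj_on_subset[OF Lw.monom_inj roots_closed])
  then have card: "card ?Z = m" using L.card_nontrivial_unity_roots[OF N] by (simp add: card_image)
  show ?thesis
  proof (rule E.monic_dvd_if_roots[OF Lw.UP_domain inj G monic(2) \<open>?G \<noteq> _\<close> _ _ _ _ h])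
    show "finite ?Z" using L.finite_nontrivial_unity_roots[OF N] by (rule finite_imageI)
    show "?Z \<subseteq> carrier (UP L)" using roots_closed by auto
    show "deg (UP K) ?G \<le> card ?Z" by (simp only: monic(1) card order_refl)
    fix z assume "z \<in> ?Z"
    then obtain \<zeta> where \<zeta>: "\<zeta> \<in> L.nontrivial_unity_roots (Suc m)"
      and z: "z = up_ring.monom (UP L) \<zeta> 1" by blast
    show "UnivPoly.eval (UP K) (UP L) ((\<circ>) \<iota>) z ?G = \<zero>\<^bsub>UP L\<^esub>"
      using root_eval_geom_sum[OF \<zeta>] root_eval_eq_root_eval_st[of \<zeta> "geom_sum s t (Suc m)"]
        subsetD[OF roots_closed \<zeta>]
      unfolding root_eval_st_def z by (simp only: geom_sum_closed vars_closed)
    show "UnivPoly.eval (UP K) (UP L) ((\<circ>) \<iota>) z h = \<zero>\<^bsub>UP L\<^esub>"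
      using zero[OF \<zeta>] unfolding root_eval_st_def z .
  qed
qed

lemma common_kernel_decomposition:
  assumes N: "add_pow L (Suc m) \<one>\<^bsub>L\<^esub> \<noteq> \<zero>\<^bsub>L\<^esub>" and g: "g \<in> carrier S"
    and zero: "\<And>\<zeta>. \<zeta> \<in> L.nontrivial_unity_roots (Suc m) \<Longrightarrow> root_eval \<zeta> g = \<zero>\<^bsub>UP L\<^esub>"
  shows "\<exists>q \<in> carrier S. \<exists>p1 \<in> carrier S. \<exists>p2 \<in> carrier S.
    g = geom_sum s t (Suc m) \<otimes> q \<oplus> (x \<otimes> p1 \<oplus> y \<otimes> p2)"
proof -
  let ?G = "geom_sum s t (Suc m)"
  have "root_eval_st \<zeta> (eval_xy_0 g) = \<zero>\<^bsub>UP L\<^esub>" if "\<zeta> \<in> L.nontrivial_unity_roots (Suc m)" for \<zeta>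
    using zero[OF that] root_eval_eq_root_eval_st[OF _ g, of \<zeta>] L.nontrivial_unity_rootsD[OF that]
    by simp
  then obtain q where q: "q \<in> carrier (UP (UP K))" "eval_xy_0 g = eval_xy_0 ?G \<otimes>\<^bsub>UP (UP K)\<^esub> q"
    using eval_xy_0_geom_sum_dvd[OF N ring_hom_closed[OF eval_xy_0_ring_hom g]] by blast
  have "eval_xy_0 ?G \<in> carrier (UP (UP K))" by (intro ring_hom_closed[OF eval_xy_0_ring_hom]) simp
  then have "embed_st (eval_xy_0 g) = ?G \<otimes> embed_st q"
    unfolding q(2) using ring_hom_mult[OF embed_st_ring_hom _ q(1), of "eval_xy_0 ?G"]
    by (simp only: embed_st_geom_sum)
  then show ?thesis
    using eval_xy_0_decomposition[OF g] ring_hom_closed[OF embed_st_ring_hom q(1)] by metis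
qed

text \<open>The restriction to the line \<open>{(a z, b z)}\<close> in the \<open>(x, y)\<close>-plane, with values in \<open>L[w][z]\<close>.\<close>

definition line_eval where
  "line_eval \<zeta> a b = Spoly_eval K (UP (UP L)) (const_UP (UP L) \<circ> (const_UP L \<circ> \<iota>))
    (up_ring.monom (UP (UP L)) a 1) (up_ring.monom (UP (UP L)) b 1)
    (const_UP (UP L) (var_UP L)) (const_UP (UP L) (up_ring.monom (UP L) \<zeta> 1))"

lemma
  assumes \<zeta>: "\<zeta> \<in> carrier L" and a: "a \<in> carrier (UP L)" and b: "b \<in> carrier (UP L)"
  shows line_eval_ring_hom: "line_eval \<zeta> a b \<in> ring_hom S (UP (UP L))"
    and line_eval_gens: "line_eval \<zeta> a b x = up_ring.monom (UP (UP L)) a 1"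
      "line_eval \<zeta> a b y = up_ring.monom (UP (UP L)) b 1"
      "line_eval \<zeta> a b s = const_UP (UP L) (var_UP L)"
      "line_eval \<zeta> a b t = const_UP (UP L) (up_ring.monom (UP L) \<zeta> 1)"
      "k \<in> carrier K \<Longrightarrow> line_eval \<zeta> a b (Spoly_const K k) = const_UP (UP L) (const_UP L (\<iota> k))"
proof -
  have hom: "const_UP (UP L) \<circ> (const_UP L \<circ> \<iota>) \<in> ring_hom K (UP (UP L))"
    by (rule ring_hom_trans[OF const_\<iota>_ring_hom Lwz.const_ring_hom])
  show "line_eval \<zeta> a b \<in> ring_hom S (UP (UP L))"
    unfolding line_eval_def using a b \<zeta> by (intro Spoly_eval_ring_hom Lwz.UP_cring hom) simp_all
  show "line_eval \<zeta> a b x = up_ring.monom (UP (UP L)) a 1"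
      "line_eval \<zeta> a b y = up_ring.monom (UP (UP L)) b 1"
      "line_eval \<zeta> a b s = const_UP (UP L) (var_UP L)"
      "line_eval \<zeta> a b t = const_UP (UP L) (up_ring.monom (UP L) \<zeta> 1)"
      "k \<in> carrier K \<Longrightarrow> line_eval \<zeta> a b (Spoly_const K k) = const_UP (UP L) (const_UP L (\<iota> k))"
    unfolding line_eval_def using a b \<zeta>
    by (simp_all add: Spoly_eval_vars Spoly_eval_const Lwz.UP_cring hom del: One_nat_def)
qed

lemma line_eval_embed_st:
  assumes ab: "\<zeta> \<in> carrier L" "a \<in> carrier (UP L)" "b \<in> carrier (UP L)" and p: "p \<in> carrier S"
  shows "line_eval \<zeta> a b (embed_st (eval_xy_0 p)) = const_UP (UP L) (root_eval \<zeta> p)"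
proof -
  have "(line_eval \<zeta> a b \<circ> (embed_st \<circ> eval_xy_0)) p = (const_UP (UP L) \<circ> root_eval \<zeta>) p"
  proof (rule Spoly_hom_eqI[OF Lwz.UP_cring _ _ _ _ _ _ _ p])
    show "line_eval \<zeta> a b \<circ> (embed_st \<circ> eval_xy_0) \<in> ring_hom S (UP (UP L))"
      by (intro ring_hom_trans[OF _ line_eval_ring_hom[OF ab]]
          ring_hom_trans[OF eval_xy_0_ring_hom embed_st_ring_hom])
    show "const_UP (UP L) \<circ> root_eval \<zeta> \<in> ring_hom S (UP (UP L))"
      by (rule ring_hom_trans[OF root_eval_ring_hom[OF ab(1)] Lwz.const_ring_hom])
    have "embed_st \<zero>\<^bsub>UP (UP K)\<^esub> = \<zero>" "line_eval \<zeta> a b \<zero> = \<zero>\<^bsub>UP (UP L)\<^esub>"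
      by (rule ring_hom_zero[OF embed_st_ring_hom Kst.UP_ring ring_axioms],
          rule ring_hom_zero[OF line_eval_ring_hom[OF ab] ring_axioms Lwz.UP_ring])
    then show "(line_eval \<zeta> a b \<circ> (embed_st \<circ> eval_xy_0)) x = (const_UP (UP L) \<circ> root_eval \<zeta>) x"
      "(line_eval \<zeta> a b \<circ> (embed_st \<circ> eval_xy_0)) y = (const_UP (UP L) \<circ> root_eval \<zeta>) y"
      by (simp_all add: eval_xy_0_gens root_eval_gens ab)
  qed (simp_all add: eval_xy_0_gens embed_st_gens root_eval_gens line_eval_gens ab del: One_nat_def)
  then show ?thesis by simp
qed

lemma line_eval_eq:
  assumes ab: "\<zeta> \<in> carrier L" "a \<in> carrier (UP L)" "b \<in> carrier (UP L)"
    and p: "p \<in> carrier S" "p1 \<in> carrier S" "p2 \<in> carrier S"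
    and eq: "p = embed_st (eval_xy_0 p) \<oplus> (x \<otimes> p1 \<oplus> y \<otimes> p2)"
  shows "line_eval \<zeta> a b p = const_UP (UP L) (root_eval \<zeta> p) \<oplus>\<^bsub>UP (UP L)\<^esub>
    (up_ring.monom (UP (UP L)) a 1 \<otimes>\<^bsub>UP (UP L)\<^esub> line_eval \<zeta> a b p1 \<oplus>\<^bsub>UP (UP L)\<^esub>
     up_ring.monom (UP (UP L)) b 1 \<otimes>\<^bsub>UP (UP L)\<^esub> line_eval \<zeta> a b p2)"
proof -
  interpret h: ring_hom_cring S "UP (UP L)" "line_eval \<zeta> a b"
    by (rule ring_hom_cringI[OF is_cring Lwz.UP_cring line_eval_ring_hom[OF ab]])
  have st: "embed_st (eval_xy_0 p) \<in> carrier S"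
    by (intro ring_hom_closed[OF embed_st_ring_hom] ring_hom_closed[OF eval_xy_0_ring_hom] p)
  show ?thesis
    by (subst eq)
      (use st p in \<open>simp add: line_eval_gens[OF ab] line_eval_embed_st[OF ab] del: One_nat_def\<close>)
qed

lemma coeff_line_eval_0:
  assumes ab: "\<zeta> \<in> carrier L" "a \<in> carrier (UP L)" "b \<in> carrier (UP L)" and p: "p \<in> carrier S"
  shows "up_ring.coeff (UP (UP L)) (line_eval \<zeta> a b p) 0 = root_eval \<zeta> p"
proof -
  obtain p1 p2 where p12: "p1 \<in> carrier S" "p2 \<in> carrier S"
    and eq: "p = embed_st (eval_xy_0 p) \<oplus> (x \<otimes> p1 \<oplus> y \<otimes> p2)"
    using eval_xy_0_decomposition[OF p] by blast
  have "root_eval \<zeta> p \<in> carrier (UP L)" "line_eval \<zeta> a b p1 \<in> carrier (UP (UP L))"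
    "line_eval \<zeta> a b p2 \<in> carrier (UP (UP L))"
    using p p12 ab
    by (simp_all add: ring_hom_closed[OF root_eval_ring_hom]
        ring_hom_closed[OF line_eval_ring_hom])
  then show ?thesis using ab by (simp add: line_eval_eq[OF ab p p12 eq])
qed

lemma coeff_line_eval_1:
  assumes \<zeta>: "\<zeta> \<in> carrier L" and p: "p \<in> carrier S"
  obtains \<alpha> \<beta> where "\<alpha> \<in> carrier (UP L)" "\<beta> \<in> carrier (UP L)"
    "\<And>a b. a \<in> carrier (UP L) \<Longrightarrow> b \<in> carrier (UP L) \<Longrightarrow>
      up_ring.coeff (UP (UP L)) (line_eval \<zeta> a b p) 1 = a \<otimes>\<^bsub>UP L\<^esub> \<alpha> \<oplus>\<^bsub>UP L\<^esub> b \<otimes>\<^bsub>UP L\<^esub> \<beta>"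
proof -
  obtain p1 p2 where p12: "p1 \<in> carrier S" "p2 \<in> carrier S"
    and eq: "p = embed_st (eval_xy_0 p) \<oplus> (x \<otimes> p1 \<oplus> y \<otimes> p2)"
    using eval_xy_0_decomposition[OF p] by blast
  have closed: "root_eval \<zeta> r \<in> carrier (UP L)" if "r \<in> carrier S" for r
    by (rule ring_hom_closed[OF root_eval_ring_hom[OF \<zeta>] that])
  have "up_ring.coeff (UP (UP L)) (line_eval \<zeta> a b p) 1
      = a \<otimes>\<^bsub>UP L\<^esub> root_eval \<zeta> p1 \<oplus>\<^bsub>UP L\<^esub> b \<otimes>\<^bsub>UP L\<^esub> root_eval \<zeta> p2"
    if a: "a \<in> carrier (UP L)" and b: "b \<in> carrier (UP L)" for a b
  proof -
    have lc: "line_eval \<zeta> a b r \<in> carrier (UP (UP L))" if "r \<in> carrier S" for r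
      by (rule ring_hom_closed[OF line_eval_ring_hom[OF \<zeta> a b] that])
    have "up_ring.coeff (UP (UP L)) (up_ring.monom (UP (UP L)) d 1 \<otimes>\<^bsub>UP (UP L)\<^esub> line_eval \<zeta> a b r) 1
        = d \<otimes>\<^bsub>UP L\<^esub> root_eval \<zeta> r" if "d \<in> carrier (UP L)" "r \<in> carrier S" for d r
      using Lwz.coeff_monom_mult[OF that(1) lc[OF that(2)], of 1 0]
      by (simp only: coeff_line_eval_0[OF \<zeta> a b that(2)] add_0)
    then show ?thesis
      unfolding line_eval_eq[OF \<zeta> a b p p12 eq] using p p12 a b lc closed
      by (simp del: Lwz.coeff_mult One_nat_def)
  qed
  then show thesis using that closed p12 by blast
qed

lemma line_eval_relation:
  assumes ab: "\<zeta> \<in> carrier L" "a \<in> carrier (UP L)" "b \<in> carrier (UP L)"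
    and pqr: "p \<in> carrier S" "q \<in> carrier S" "r \<in> carrier S" "g \<in> carrier S"
    and F: "line_eval \<zeta> a b F = \<zero>\<^bsub>UP (UP L)\<^esub>"
    and eq: "g \<otimes> (x [^] (2::nat) \<otimes> y [^] Suc m)
      = r \<otimes> F \<oplus> (p \<otimes> x [^] (m + 2) \<oplus> q \<otimes> y [^] (m + 2))"
  shows "root_eval \<zeta> g \<otimes>\<^bsub>UP L\<^esub> (a [^]\<^bsub>UP L\<^esub> (2::nat) \<otimes>\<^bsub>UP L\<^esub> b [^]\<^bsub>UP L\<^esub> Suc m)
    = up_ring.coeff (UP (UP L)) (line_eval \<zeta> a b p) 1 \<otimes>\<^bsub>UP L\<^esub> a [^]\<^bsub>UP L\<^esub> (m + 2)
      \<oplus>\<^bsub>UP L\<^esub> up_ring.coeff (UP (UP L)) (line_eval \<zeta> a b q) 1 \<otimes>\<^bsub>UP L\<^esub> b [^]\<^bsub>UP L\<^esub> (m + 2)"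
proof -
  interpret h: ring_hom_cring S "UP (UP L)" "line_eval \<zeta> a b"
    by (rule ring_hom_cringI[OF is_cring Lwz.UP_cring line_eval_ring_hom[OF ab]])
  let ?h = "line_eval \<zeta> a b" and ?coeff = "up_ring.coeff (UP (UP L))"
    and ?z = "up_ring.monom (UP (UP L))"
  let ?e = "a [^]\<^bsub>UP L\<^esub> (2::nat) \<otimes>\<^bsub>UP L\<^esub> b [^]\<^bsub>UP L\<^esub> Suc m"
  have x: "?h (x [^] k) = ?z (a [^]\<^bsub>UP L\<^esub> k) k"
    and y: "?h (y [^] k) = ?z (b [^]\<^bsub>UP L\<^esub> k) k" for k :: nat
    using ab by (simp_all add: line_eval_gens Lwz.monom_pow)
  have "?h g \<otimes>\<^bsub>UP (UP L)\<^esub> ?z ?e (2 + Suc m) = ?h (g \<otimes> (x [^] (2::nat) \<otimes> y [^] Suc m))"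
    by (simp only: h.hom_mult m_closed nat_pow_closed vars_closed pqr x y Lwz.monom_mult
        Lw.P.nat_pow_closed ab)
  also have "\<dots> = ?h p \<otimes>\<^bsub>UP (UP L)\<^esub> ?z (a [^]\<^bsub>UP L\<^esub> (m + 2)) (m + 2)
      \<oplus>\<^bsub>UP (UP L)\<^esub> ?h q \<otimes>\<^bsub>UP (UP L)\<^esub> ?z (b [^]\<^bsub>UP L\<^esub> (m + 2)) (m + 2)"
    unfolding eq
    by (simp only: h.hom_mult h.hom_add m_closed a_closed nat_pow_closed vars_closed
        quartic_closed pqr x y F h.hom_closed Lwz.P.l_null Lwz.P.l_zero Lwz.P.r_null Lwz.P.m_closed
        Lwz.P.a_closed Lwz.monom_closed Lw.P.nat_pow_closed ab)
  finally have "?coeff (?h g \<otimes>\<^bsub>UP (UP L)\<^esub> ?z ?e (2 + Suc m)) (0 + (2 + Suc m))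
      = ?coeff (?h p \<otimes>\<^bsub>UP (UP L)\<^esub> ?z (a [^]\<^bsub>UP L\<^esub> (m + 2)) (m + 2)) (1 + (m + 2))
        \<oplus>\<^bsub>UP L\<^esub> ?coeff (?h q \<otimes>\<^bsub>UP (UP L)\<^esub> ?z (b [^]\<^bsub>UP L\<^esub> (m + 2)) (m + 2)) (1 + (m + 2))"
    using pqr ab by (simp del: Lwz.coeff_mult Lw.P.nat_pow_Suc Lwz.monom_mult)
  then show ?thesis
    by (simp only: Lwz.coeff_mult_monom coeff_line_eval_0 h.hom_closed Lw.P.nat_pow_closed
        Lw.P.m_closed pqr ab)
qed

lemma line_eval_quartic:
  assumes ab: "\<zeta> \<in> carrier L" "a \<in> carrier (UP L)" "b \<in> carrier (UP L)"
  shows "line_eval \<zeta> a b F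
    = up_ring.monom (UP (UP L)) (quartic (UP L) a b (var_UP L) (up_ring.monom (UP L) \<zeta> 1)) 4"
proof -
  interpret h: ring_hom_cring S "UP (UP L)" "line_eval \<zeta> a b"
    by (rule ring_hom_cringI[OF is_cring Lwz.UP_cring line_eval_ring_hom[OF ab]])
  show ?thesis
    using ab Lwz.quartic_monom[OF ab(2,3), of "var_UP L" "up_ring.monom (UP L) \<zeta> 1"]
    by (simp only: h.hom_quartic vars_closed line_eval_gens Lw.monom_closed L.one_closed)
qed

lemma root_eval_eq_zero:
  assumes \<zeta>: "\<zeta> \<in> L.nontrivial_unity_roots (Suc m)"
    and pqr: "p \<in> carrier S" "q \<in> carrier S" "r \<in> carrier S"
    and g: "g \<in> carrier S"
    and eq: "g \<otimes> (x [^] (2::nat) \<otimes> y [^] Suc m)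
      = r \<otimes> F \<oplus> (p \<otimes> x [^] (m + 2) \<oplus> q \<otimes> y [^] (m + 2))"
  shows "root_eval \<zeta> g = \<zero>\<^bsub>UP L\<^esub>"
proof -
  note \<zeta>L = L.nontrivial_unity_rootsD[OF \<zeta>]
  let ?\<phi> = "root_eval \<zeta>" and ?z = "const_UP L \<zeta>"
  have \<phi>g: "?\<phi> g \<in> carrier (UP L)" by (rule ring_hom_closed[OF root_eval_ring_hom[OF \<zeta>L(1)] g])
  have z: "?z \<in> carrier (UP L)" using \<zeta>L(1) by simp
  have zN: "?z [^]\<^bsub>UP L\<^esub> Suc m = \<one>\<^bsub>UP L\<^esub>"
    unfolding Lw.monom_pow[OF \<zeta>L(1)] \<zeta>L(2) by simp
  obtain \<alpha> \<beta> where p1: "\<alpha> \<in> carrier (UP L)" "\<beta> \<in> carrier (UP L)"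
    "\<And>a b. a \<in> carrier (UP L) \<Longrightarrow> b \<in> carrier (UP L) \<Longrightarrow>
      up_ring.coeff (UP (UP L)) (line_eval \<zeta> a b p) 1 = a \<otimes>\<^bsub>UP L\<^esub> \<alpha> \<oplus>\<^bsub>UP L\<^esub> b \<otimes>\<^bsub>UP L\<^esub> \<beta>"
    using coeff_line_eval_1[OF \<zeta>L(1) pqr(1)] by blast
  obtain \<gamma> \<delta> where q1: "\<gamma> \<in> carrier (UP L)" "\<delta> \<in> carrier (UP L)"
    "\<And>a b. a \<in> carrier (UP L) \<Longrightarrow> b \<in> carrier (UP L) \<Longrightarrow>
      up_ring.coeff (UP (UP L)) (line_eval \<zeta> a b q) 1 = a \<otimes>\<^bsub>UP L\<^esub> \<gamma> \<oplus>\<^bsub>UP L\<^esub> b \<otimes>\<^bsub>UP L\<^esub> \<delta>"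
    using coeff_line_eval_1[OF \<zeta>L(1) pqr(2)] by blast
  show ?thesis
  proof (rule Lw.eq_zero_if_four_points[OF \<phi>g z p1(1,2) q1(1,2) zN])
    show "?z \<noteq> \<one>\<^bsub>UP L\<^esub>" using \<zeta>L Lw.monom_inj[of 0] by (auto dest: inj_onD simp flip: Lw.monom_one)
    fix a b
    assume points: "(a, b) \<in> {(\<one>\<^bsub>UP L\<^esub>, \<zero>\<^bsub>UP L\<^esub>), (\<zero>\<^bsub>UP L\<^esub>, \<one>\<^bsub>UP L\<^esub>),
      (\<one>\<^bsub>UP L\<^esub>, \<one>\<^bsub>UP L\<^esub>), (?z, \<one>\<^bsub>UP L\<^esub>)}"
    then have ab: "a \<in> carrier (UP L)" "b \<in> carrier (UP L)" using z by auto
    have "var_UP L \<otimes>\<^bsub>UP L\<^esub> ?z = up_ring.monom (UP L) \<zeta> 1"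
      using Lw.monom_mult[of "\<one>\<^bsub>L\<^esub>" \<zeta> 1 0] \<zeta>L(1) by simp
    then have "quartic (UP L) a b (var_UP L) (up_ring.monom (UP L) \<zeta> 1) = \<zero>\<^bsub>UP L\<^esub>"
      using points \<zeta>L(1) z by (auto simp: quartic_def Lw.integral_iff)
    then have "line_eval \<zeta> a b F = \<zero>\<^bsub>UP (UP L)\<^esub>"
      by (simp add: line_eval_quartic[OF \<zeta>L(1) ab])
    from line_eval_relation[OF \<zeta>L(1) ab pqr g this eq]
    show "?\<phi> g \<otimes>\<^bsub>UP L\<^esub> (a [^]\<^bsub>UP L\<^esub> (2::nat) \<otimes>\<^bsub>UP L\<^esub> b [^]\<^bsub>UP L\<^esub> Suc m)
      = (a \<otimes>\<^bsub>UP L\<^esub> \<alpha> \<oplus>\<^bsub>UP L\<^esub> b \<otimes>\<^bsub>UP L\<^esub> \<beta>) \<otimes>\<^bsub>UP L\<^esub> a [^]\<^bsub>UP L\<^esub> (m + 2)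
        \<oplus>\<^bsub>UP L\<^esub> (a \<otimes>\<^bsub>UP L\<^esub> \<gamma> \<oplus>\<^bsub>UP L\<^esub> b \<otimes>\<^bsub>UP L\<^esub> \<delta>) \<otimes>\<^bsub>UP L\<^esub> b [^]\<^bsub>UP L\<^esub> (m + 2)"
      unfolding p1(3)[OF ab] q1(3)[OF ab] .
  qed
qed

lemma mult_socle_elem_mem_iff:
  assumes N: "add_pow L (Suc m) \<one>\<^bsub>L\<^esub> \<noteq> \<zero>\<^bsub>L\<^esub>" and g: "g \<in> carrier S"
  shows "g \<otimes> socle_elem m \<in> power_ideal (m + 2)
    \<longleftrightarrow> (\<forall>\<zeta> \<in> L.nontrivial_unity_roots (Suc m). root_eval \<zeta> g = \<zero>\<^bsub>UP L\<^esub>)"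
proof
  assume "\<forall>\<zeta> \<in> L.nontrivial_unity_roots (Suc m). root_eval \<zeta> g = \<zero>\<^bsub>UP L\<^esub>"
  then obtain q p1 p2 where "q \<in> carrier S" "p1 \<in> carrier S" "p2 \<in> carrier S"
    "g = geom_sum s t (Suc m) \<otimes> q \<oplus> (x \<otimes> p1 \<oplus> y \<otimes> p2)"
    using common_kernel_decomposition[OF N g] by blast
  then show "g \<otimes> socle_elem m \<in> power_ideal (m + 2)"
    using combination_mult_socle_elem_mem by blast
next
  assume mem: "g \<otimes> socle_elem m \<in> power_ideal (m + 2)"
  show "\<forall>\<zeta> \<in> L.nontrivial_unity_roots (Suc m). root_eval \<zeta> g = \<zero>\<^bsub>UP L\<^esub>"
  proof
    fix \<zeta> assume \<zeta>: "\<zeta> \<in> L.nontrivial_unity_roots (Suc m)"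
    note \<zeta>L = L.nontrivial_unity_rootsD(1)[OF \<zeta>]
    interpret \<phi>: ring_hom_cring S "UP L" "root_eval \<zeta>"
      by (rule ring_hom_cringI[OF is_cring Lw.UP_cring root_eval_ring_hom[OF \<zeta>L]])
    have "(g \<otimes> s) \<otimes> (x [^] (2::nat) \<otimes> y [^] Suc m) \<in> power_ideal (m + 2)"
      using mem g by (simp add: socle_elem_def m_assoc del: nat_pow_Suc)
    then obtain p q r where pqr: "p \<in> carrier S" "q \<in> carrier S" "r \<in> carrier S"
      and eq: "(g \<otimes> s) \<otimes> (x [^] (2::nat) \<otimes> y [^] Suc m)
        = r \<otimes> F \<oplus> (p \<otimes> x [^] (m + 2) \<oplus> q \<otimes> y [^] (m + 2))"
      by (rule mem_power_idealE)
    have "root_eval \<zeta> (g \<otimes> s) = \<zero>\<^bsub>UP L\<^esub>"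
      by (rule root_eval_eq_zero[OF \<zeta> pqr _ eq]) (use g in simp)
    moreover have "root_eval \<zeta> s \<noteq> \<zero>\<^bsub>UP L\<^esub>"
      using \<zeta>L inj_onD[OF Lw.monom_inj[of 1], of "\<one>\<^bsub>L\<^esub>" "\<zero>\<^bsub>L\<^esub>"] by (auto simp: root_eval_gens)
    ultimately show "root_eval \<zeta> g = \<zero>\<^bsub>UP L\<^esub>" using g by (simp add: Lw.integral_iff)
  qed
qed

lemma exists_ass_prime:
  assumes N: "add_pow L (Suc m) \<one>\<^bsub>L\<^esub> \<noteq> \<zero>\<^bsub>L\<^esub>" and \<zeta>: "\<zeta> \<in> L.nontrivial_unity_roots (Suc m)"
  obtains P where "P \<in> ass_quot S (power_ideal (m + 2))" "t [^] Suc m \<ominus> s [^] Suc m \<in> P"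
    "\<And>k::nat. t [^] k \<ominus> s [^] k \<in> P \<Longrightarrow> \<zeta> [^]\<^bsub>L\<^esub> k = \<one>\<^bsub>L\<^esub>"
proof -
  define ker where "ker \<xi> = a_kernel S (UP L) (root_eval \<xi>)" for \<xi>
  note roots_closed = L.nontrivial_unity_rootsD(1)
  have mem_ker: "p \<in> ker \<xi> \<longleftrightarrow> p \<in> carrier S \<and> root_eval \<xi> p = \<zero>\<^bsub>UP L\<^esub>" for p \<xi>
    unfolding ker_def a_kernel_def' by blast
  have prime: "primeideal (ker \<xi>) S" if "\<xi> \<in> L.nontrivial_unity_roots (Suc m)" for \<xi>
    unfolding ker_def
    by (intro ring_hom_ring.kernel_primeideal ring_hom_ringI2 ring_axioms Lw.ring_axioms
        root_eval_ring_hom roots_closed[OF that] is_cring Lw.UP_domain)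
  obtain P v where P: "P \<in> ker ` L.nontrivial_unity_roots (Suc m)" "P \<subseteq> ker \<zeta>"
    and v: "v \<in> carrier S"
    and colon: "P = {r \<in> carrier S. \<forall>A \<in> ker ` L.nontrivial_unity_roots (Suc m). r \<otimes> v \<in> A}"
    by (rule minimal_prime_eq_colon[of "ker ` L.nontrivial_unity_roots (Suc m)" S "ker \<zeta>"])
      (use L.finite_nontrivial_unity_roots[OF N] prime \<zeta> in auto)
  obtain \<xi> where \<xi>: "\<xi> \<in> L.nontrivial_unity_roots (Suc m)" "P = ker \<xi>" using P(1) by blast
  have "P = {r \<in> carrier S. r \<otimes> (v \<otimes> socle_elem m) \<in> power_ideal (m + 2)}"
  proof -
    have "(\<forall>A \<in> ker ` L.nontrivial_unity_roots (Suc m). r \<otimes> v \<in> A)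
        \<longleftrightarrow> r \<otimes> (v \<otimes> socle_elem m) \<in> power_ideal (m + 2)"
      if r: "r \<in> carrier S" for r
      using mult_socle_elem_mem_iff[OF N m_closed[OF r v]] r v
      by (simp add: mem_ker m_assoc del: nat_pow_Suc)
    then show ?thesis unfolding colon by blast
  qed
  moreover have "primeideal P S" "v \<otimes> socle_elem m \<in> carrier S"
    using prime[OF \<xi>(1)] \<xi>(2) v by simp_all
  ultimately have "P \<in> ass_quot S (power_ideal (m + 2))" unfolding ass_quot_def by blast
  moreover have "t [^] Suc m \<ominus> s [^] Suc m \<in> P"
    using root_eval_power_diff_eq_zero_iff[OF roots_closed[OF \<xi>(1)], of "Suc m"] \<xi>(2)
        L.nontrivial_unity_rootsD(2)[OF \<xi>(1)]
    by (simp add: mem_ker del: nat_pow_Suc L.nat_pow_Suc)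
  moreover have "\<zeta> [^]\<^bsub>L\<^esub> k = \<one>\<^bsub>L\<^esub>" if "t [^] k \<ominus> s [^] k \<in> P" for k :: nat
    using that P(2) root_eval_power_diff_eq_zero_iff[OF roots_closed[OF \<zeta>]] mem_ker by blast
  ultimately show thesis using that by blast
qed

lemma exists_ass_prime_ringR:
  assumes N: "add_pow L (Suc m) \<one>\<^bsub>L\<^esub> \<noteq> \<zero>\<^bsub>L\<^esub>" and \<zeta>: "\<zeta> \<in> L.nontrivial_unity_roots (Suc m)"
  obtains P where
    "P \<in> ass_quot (ringR K) (Idl\<^bsub>ringR K\<^esub> {xR K [^]\<^bsub>ringR K\<^esub> (m + 2), yR K [^]\<^bsub>ringR K\<^esub> (m + 2)})"
    "power_diffR (Suc m) \<in> P" "\<And>k. power_diffR k \<in> P \<Longrightarrow> \<zeta> [^]\<^bsub>L\<^esub> k = \<one>\<^bsub>L\<^esub>"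
proof -
  interpret I: ideal "PIdl F" S by (rule ideal_F)
  obtain P where P: "P \<in> ass_quot S (power_ideal (m + 2))" "t [^] Suc m \<ominus> s [^] Suc m \<in> P"
    and order: "\<And>k::nat. t [^] k \<ominus> s [^] k \<in> P \<Longrightarrow> \<zeta> [^]\<^bsub>L\<^esub> k = \<one>\<^bsub>L\<^esub>"
    by (rule exists_ass_prime[OF N \<zeta>]) blast
  have "ideal P S" using P(1) by (simp add: ass_quot_def primeideal_def)
  moreover have "PIdl F \<subseteq> P"
    using F_subset_power_ideal ass_quot_superset[OF ideal_power_ideal P(1)] by (rule subset_trans)
  ultimately have mem_iff: "power_diffR k \<in> (+>) (PIdl F) ` P \<longleftrightarrow> t [^] k \<ominus> s [^] k \<in> P" for k
    unfolding power_diffR_def by (rule I.coset_image_mem_iff) simp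
  have "(+>) (PIdl F) ` P \<in> ass_quot (ringR K)
      (Idl\<^bsub>ringR K\<^esub> {xR K [^]\<^bsub>ringR K\<^esub> (m + 2), yR K [^]\<^bsub>ringR K\<^esub> (m + 2)})"
    using I.ass_quot_coset_image[OF ideal_power_ideal F_subset_power_ideal P(1)]
    unfolding power_ideal_coset_image ringR_eq(1)[symmetric] .
  then show thesis by (rule that) (use P(2) order mem_iff in blast)+
qed

lemma add_pow_one_nonzero:
  fixes n :: nat
  assumes "add_pow K n \<one>\<^bsub>K\<^esub> \<noteq> \<zero>\<^bsub>K\<^esub>"
  shows "add_pow L n \<one>\<^bsub>L\<^esub> \<noteq> \<zero>\<^bsub>L\<^esub>"
proof -
  have "\<iota> (add_pow K n \<one>\<^bsub>K\<^esub>) = add_pow L n \<one>\<^bsub>L\<^esub>" by (induction n) simp_all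
  then show ?thesis
    using assms inj_onD[OF inj_on_\<iota>, of "add_pow K n \<one>\<^bsub>K\<^esub>" "\<zero>\<^bsub>K\<^esub>"] by auto
qed

lemma infinite_ass_primes:
  fixes \<S> :: "nat set"
  assumes "infinite {m. m + 2 \<in> \<S> \<and> add_pow L (Suc m) \<one>\<^bsub>L\<^esub> \<noteq> \<zero>\<^bsub>L\<^esub>}" (is "infinite ?M")
  shows "infinite (\<Union>n \<in> \<S>. ass_quot (ringR K)
    (Idl\<^bsub>ringR K\<^esub> {xR K [^]\<^bsub>ringR K\<^esub> n, yR K [^]\<^bsub>ringR K\<^esub> n}))" (is "infinite ?U")
proof
  assume "finite ?U"
  let ?Z = "\<Union>m \<in> ?M. L.nontrivial_unity_roots (Suc m)"
  have "infinite (\<Union>N \<in> Suc ` ?M. L.nontrivial_unity_roots N)"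
    by (rule L.infinite_nontrivial_unity_roots) (use assms finite_imageD[of Suc ?M] in auto)
  then have "infinite ?Z" by simp
  let ?rel = "\<lambda>\<zeta> P. (\<exists>m \<in> ?M. power_diffR (Suc m) \<in> P)
    \<and> (\<forall>k. power_diffR k \<in> P \<longrightarrow> \<zeta> [^]\<^bsub>L\<^esub> k = \<one>\<^bsub>L\<^esub>)"
  have "\<exists>P \<in> ?U. ?rel \<zeta> P" if \<zeta>: "\<zeta> \<in> ?Z" for \<zeta>
  proof -
    obtain m where m: "m \<in> ?M" "\<zeta> \<in> L.nontrivial_unity_roots (Suc m)" using \<zeta> by blast
    obtain P where
      "P \<in> ass_quot (ringR K) (Idl\<^bsub>ringR K\<^esub> {xR K [^]\<^bsub>ringR K\<^esub> (m + 2), yR K [^]\<^bsub>ringR K\<^esub> (m + 2)})"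
      "power_diffR (Suc m) \<in> P" "\<And>k. power_diffR k \<in> P \<Longrightarrow> \<zeta> [^]\<^bsub>L\<^esub> k = \<one>\<^bsub>L\<^esub>"
      by (rule exists_ass_prime_ringR[OF _ m(2)]) (use m(1) in auto)
    then show ?thesis using m(1) by blast
  qed
  then obtain P where inf: "infinite {\<zeta> \<in> ?Z. ?rel \<zeta> P}"
    using pigeonhole_infinite_rel[OF \<open>infinite ?Z\<close> \<open>finite ?U\<close>, of ?rel] by blast
  then obtain m where m: "m \<in> ?M" "power_diffR (Suc m) \<in> P"
    using not_finite_existsD by blast
  have "{\<zeta> \<in> ?Z. ?rel \<zeta> P} \<subseteq> L.nontrivial_unity_roots (Suc m)"
    using m(2) unfolding L.nontrivial_unity_roots_def by blast
  then show False
    using inf m(1) L.finite_nontrivial_unity_roots[of "Suc m"] finite_subset by blast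
qed

end

section \<open>Infinitely many associated primes\<close>

lemma infinite_shift_nat:
  fixes A :: "nat set"
  assumes "infinite A" shows "infinite {m. m + k \<in> A}"
proof
  assume "finite {m. m + k \<in> A}"
  moreover have "A \<subseteq> {..<k} \<union> (\<lambda>m. m + k) ` {m. m + k \<in> A}"
  proof
    fix n assume "n \<in> A"
    then show "n \<in> {..<k} \<union> (\<lambda>m. m + k) ` {m. m + k \<in> A}"
      by (cases "n < k") (auto intro!: image_eqI[of _ _ "n - k"])
  qed
  ultimately show False using assms finite_subset by blast
qed

lemma (in domain) add_pow_pred_nonzero:
  assumes "add_pow R p \<one> = \<zero>" "Suc n = p ^ e" "n > 0"
  shows "add_pow R n \<one> \<noteq> \<zero>"
proof
  assume "add_pow R n \<one> = \<zero>"
  have "e \<noteq> 0" using assms(2,3) by (cases e) auto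
  then obtain k where "Suc n = p * k" using assms(2) by (cases e) auto
  then have "add_pow R (Suc n) \<one> = \<zero>"
    using add.nat_pow_pow[of \<one> k p] assms(1) by (simp add: mult.commute)
  then show False using \<open>add_pow R n \<one> = \<zero>\<close> by simp
qed

lemma (in domain) infinite_nonzero_predecessors:
  fixes A :: "nat set"
  assumes "infinite A"
    and "(\<forall>n::nat. n > 0 \<longrightarrow> add_pow R n \<one> \<noteq> \<zero>)
      \<or> (\<exists>p::nat. add_pow R p \<one> = \<zero> \<and> infinite {n \<in> A. \<exists>e::nat. n = p ^ e})"
  shows "infinite {m. m + 2 \<in> A \<and> add_pow R (Suc m) \<one> \<noteq> \<zero>}"
  using assms(2)
proof
  assume "\<forall>n::nat. n > 0 \<longrightarrow> add_pow R n \<one> \<noteq> \<zero>"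
  then show ?thesis using infinite_shift_nat[OF assms(1), of 2] by (simp del: add.nat_pow_Suc)
next
  assume "\<exists>p::nat. add_pow R p \<one> = \<zero> \<and> infinite {n \<in> A. \<exists>e::nat. n = p ^ e}"
  then obtain p :: nat where p: "add_pow R p \<one> = \<zero>" and inf: "infinite {n \<in> A. \<exists>e::nat. n = p ^ e}"
    by blast
  have "{m. m + 2 \<in> {n \<in> A. \<exists>e::nat. n = p ^ e}} \<subseteq> {m. m + 2 \<in> A \<and> add_pow R (Suc m) \<one> \<noteq> \<zero>}"
    using add_pow_pred_nonzero[OF p, of "Suc m" for m] by (auto simp del: add.nat_pow_Suc)
  then show ?thesis using infinite_shift_nat[OF inf, of 2] infinite_super by blast
qed

lemma (in field) exists_algebraically_closed_extension:
  obtains L :: "(('a list \<times> nat) multiset \<Rightarrow> 'a) ring" and \<iota> where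
    "algebraically_closed L" "\<iota> \<in> ring_hom R L"
proof -
  interpret L: algebraic_closure alg_closure "indexed_const ` carrier R"
    by (rule alg_closureE(1))
  show thesis by (rule that[OF L.algebraically_closed_axioms alg_closureE(2)])
qed

theorem theorem2p1:
  fixes K :: "('a, 'm) ring_scheme" and \<S> :: "nat set"
  assumes "field K"
    and "infinite \<S>" and "\<forall>n \<in> \<S>. n > 0"
    and "(\<forall>n::nat. n > 0 \<longrightarrow> add_pow K n \<one>\<^bsub>K\<^esub> \<noteq> \<zero>\<^bsub>K\<^esub>)
         \<or> (\<exists>p::nat. Factorial_Ring.prime p \<and> add_pow K p \<one>\<^bsub>K\<^esub> = \<zero>\<^bsub>K\<^esub>
               \<and> infinite {n \<in> \<S>. \<exists>e::nat. n = p ^ e})"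
  shows "infinite (\<Union>n \<in> \<S>. ass_quot (ringR K)
           (Idl\<^bsub>ringR K\<^esub> {xR K [^]\<^bsub>ringR K\<^esub> n, yR K [^]\<^bsub>ringR K\<^esub> n}))"
proof -
  interpret K: field K by fact
  obtain L :: "(('a list \<times> nat) multiset \<Rightarrow> 'a) ring" and \<iota>
    where L: "algebraically_closed L" and \<iota>: "\<iota> \<in> ring_hom K L"
    by (rule K.exists_algebraically_closed_extension)
  interpret Spoly_extension K "Spoly K" "varx K" "vary K" "vars K" "vart K" L \<iota>
    by (intro Spoly_extension.intro Spoly_extension_axioms.intro Spoly_cring.intro K.is_cring
        assms(1) L \<iota>)
  have "infinite {m. m + 2 \<in> \<S> \<and> add_pow K (Suc m) \<one>\<^bsub>K\<^esub> \<noteq> \<zero>\<^bsub>K\<^esub>}"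
    by (rule K.infinite_nonzero_predecessors) (use assms(2,4) in blast)+
  then have "infinite {m. m + 2 \<in> \<S> \<and> add_pow L (Suc m) \<one>\<^bsub>L\<^esub> \<noteq> \<zero>\<^bsub>L\<^esub>}"
    by (rule infinite_super[rotated]) (use add_pow_one_nonzero in blast)
  then show ?thesis by (rule infinite_ass_primes)
qed

end
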